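(* Let $0<\gamma<1$ and $v_0\in\mathbb{R}$. Consider the initial value problem $$D_c^\gamma v(t)=f(t,v(t)),\qquad v(0)=v_0 .$$ Suppose there exist $T>0$, $A>0$ such that $f$ is defined and continuous on $\mathcal D=[0,T]\times[v_0-A,v_0+A]$ and such that there exists $L>0$ with $$\sup_{0\le t\le T}|f(t,v_1)-f(t,v_2)|\le L|v_1-v_2|,\qquad\forall v_1,v_2\in[v_0-A,v_0+A].$$ Then the initial value problem has a unique strong solution $v$ on $[0,T_1)$, where $$T_1=\min\Big\{T,\ \sup\Big\{t\ge0:\ \frac{M}{\Gamma(1+\gamma)}t^\gamma E_\gamma(Lt^\gamma)\le A\Big\}\Big\}>0,$$ $M=\sup_{0\le t\le T}|f(t,v_0)|$, and $E_\gamma(z)=\sum_{n=0}^\infty\frac{z^n}{\Gamma(n\gamma+1)}$ is the Mittag–Leffler function. Moreover, $v(\cdot)\in C[0,T_1]$. Further, the solution is continuous with respect to the initial value: fix $t\in(0,T_1)$ and $0<\epsilon_0<T_1-t$. Then for all $\epsilon\in(0,\epsilon_0)$ there exists $\delta_0>0$ such that for any $|\delta|\le\delta_0$, the solution $v^\delta(\cdot)$ of the fractional ODE with initial value $v_0+\delta$ exists on $(0,T_1-\epsilon_0)$ and $$|v^\delta(t)-v(t)|<\epsilon.$$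
   Context: For $S\in(0,\infty]$, $L^1_{\mathrm{loc}}[0,S)$ is the set of functions integrable on every compact subset of $[0,S)$; such functions are identified with distributions in $\mathscr D'(-\infty,S)$ by extension by zero to $t<0$. $\theta$ is the Heaviside function, $D$ the distributional derivative, $g_\alpha(t)=\theta(t)t^{\alpha-1}/\Gamma(\alpha)$ for $\alpha>0$, $g_{-\gamma}=\frac{1}{\Gamma(1-\gamma)}D(\theta(t)t^{-\gamma})$ for $0<\gamma<1$. For $\varphi\in L^1_{\mathrm{loc}}[0,S)$, $J_{-\gamma}\varphi\in\mathscr D'(-\infty,S)$ is the convolution $g_{-\gamma}*(\theta\varphi)$, i.e. the distributional derivative on $(-\infty,S)$ of the locally integrable function equal to $\frac{1}{\Gamma(1-\gamma)}\int_0^t(t-s)^{-\gamma}\varphi(s)\,ds$ for $0<t<S$ and $0$ for $t<0$. For $\varphi_0\in\mathbb{R}$ the generalized Caputo derivative of $\varphi$ associated with $\varphi_0$ is $D_c^\gamma\varphi:=J_{-\gamma}\varphi-\varphi_0g_{1-\gamma}$. $X$ (on $[0,S)$) is the set of $\varphi\in L^1_{\mathrm{loc}}[0,S)$ for which there is a (unique) $\varphi_0\in\mathbb{R}$ with $\lim_{t\to0^+}\frac1t\int_0^t|\varphi-\varphi_0|\,ds=0$; one writes $\varphi(0+):=\varphi_0$, and for $\varphi\in X$ the value $\varphi_0=\varphi(0+)$ is used in $D_c^\gamma\varphi$. Solutions: in the initial value problem, $v_0$ is the value used in the generalized Caputo derivative $D_c^\gamma v$. A function $v\in L^1_{\mathrm{loc}}[0,S)$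 is a weak solution on $[0,S)$ if $f(t,v(t))$ (set to $0$ for $t<0$) is in $\mathscr D'(-\infty,S)$ and the equation holds in the distributional sense. It is a strong solution on $[0,S)$ if (i) it is a weak solution, $v\in X$ and $v(0+)=v_0$; and (ii) both $D_c^\gamma v$ and $f(t,v(t))$ are locally integrable, so that the equation holds a.e. *)

theory Defs
  imports "HOL-Analysis.Analysis"
begin

definition L1_loc :: "real \<Rightarrow> (real \<Rightarrow> real) set" where
  "L1_loc S = {\<phi>. \<forall>K. compact K \<and> K \<subseteq> {0..<S} \<longrightarrow> \<phi> absolutely_integrable_on K}"

text \<open>Real test functions on the open half-line of all \<open>t < S\<close>. A distribution is represented by its
  action on test functions, so two distributions agree iff they agree on \<open>test_functions S\<close>.\<close>

definition test_functions :: "real \<Rightarrow> (real \<Rightarrow> real) set" where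
  "test_functions S =
     {\<psi>. (\<forall>k. (deriv ^^ k) \<psi> differentiable_on UNIV) \<and>
          compact (closure {t. \<psi> t \<noteq> 0}) \<and> closure {t. \<psi> t \<noteq> 0} \<subseteq> {..<S}}"

definition dist_eq :: "real \<Rightarrow> ((real \<Rightarrow> real) \<Rightarrow> real) \<Rightarrow> ((real \<Rightarrow> real) \<Rightarrow> real) \<Rightarrow> bool" where
  "dist_eq S F G \<longleftrightarrow> (\<forall>\<psi>\<in>test_functions S. F \<psi> = G \<psi>)"

definition dist_deriv :: "((real \<Rightarrow> real) \<Rightarrow> real) \<Rightarrow> (real \<Rightarrow> real) \<Rightarrow> real" where
  "dist_deriv F \<psi> = - F (deriv \<psi>)"

text \<open>The distribution given by a locally integrable function. For a test function \<open>\<psi>\<close> on \<open>t < S\<close>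
  the integrand vanishes for \<open>t \<ge> S\<close>, so the values of \<open>u\<close> there play no role.\<close>

definition regular_dist :: "(real \<Rightarrow> real) \<Rightarrow> (real \<Rightarrow> real) \<Rightarrow> real" where
  "regular_dist u \<psi> = (LINT t|lebesgue. u t * \<psi> t)"

definition zero_ext :: "(real \<Rightarrow> real) \<Rightarrow> real \<Rightarrow> real" where
  "zero_ext \<phi> t = (if 0 \<le> t then \<phi> t else 0)"

definition g_kernel :: "real \<Rightarrow> real \<Rightarrow> real" where
  "g_kernel \<alpha> t = (if 0 < t then t powr (\<alpha> - 1) / Gamma \<alpha> else 0)"

text \<open>The locally integrable function whose distributional derivative is \<open>J\<^bsub>-\<gamma>\<^esub> \<phi>\<close>. The inner integral
  converges for almost every \<open>t\<close> with \<open>0 < t < S\<close> when \<open>\<phi> \<in> L1_loc S\<close>.\<close>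

definition J_primitive :: "real \<Rightarrow> (real \<Rightarrow> real) \<Rightarrow> real \<Rightarrow> real" where
  "J_primitive \<gamma> \<phi> t =
     (if 0 < t then 1 / Gamma (1 - \<gamma>) * (LINT s:{0..t}|lebesgue. (t - s) powr (- \<gamma>) * \<phi> s) else 0)"

definition J_neg :: "real \<Rightarrow> (real \<Rightarrow> real) \<Rightarrow> (real \<Rightarrow> real) \<Rightarrow> real" where
  "J_neg \<gamma> \<phi> = dist_deriv (regular_dist (J_primitive \<gamma> \<phi>))"

definition caputo :: "real \<Rightarrow> real \<Rightarrow> (real \<Rightarrow> real) \<Rightarrow> (real \<Rightarrow> real) \<Rightarrow> real" where
  "caputo \<gamma> c \<phi> \<psi> = J_neg \<gamma> \<phi> \<psi> - c * regular_dist (g_kernel (1 - \<gamma>)) \<psi>"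

definition has_initial_value :: "(real \<Rightarrow> real) \<Rightarrow> real \<Rightarrow> bool" where
  "has_initial_value \<phi> c \<longleftrightarrow>
     ((\<lambda>t. 1 / t * (LINT s:{0..t}|lebesgue. \<bar>\<phi> s - c\<bar>)) \<longlongrightarrow> 0) (at_right 0)"

definition X_space :: "real \<Rightarrow> (real \<Rightarrow> real) set" where
  "X_space S = {\<phi> \<in> L1_loc S. \<exists>c. has_initial_value \<phi> c}"

definition initial_value :: "(real \<Rightarrow> real) \<Rightarrow> real" where
  "initial_value \<phi> = (THE c. has_initial_value \<phi> c)"

text \<open>\<open>Dom\<close> is the set of \<open>(t, x)\<close> on which the right-hand side \<open>f\<close> is defined; the values of \<open>f\<close>
  elsewhere are never used, because a solution must stay in \<open>Dom\<close>. As elements of \<open>L1_loc S\<close> are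
  functions up to null sets, this is required for almost every \<open>t\<close>. That the function \<open>f t (v t)\<close>
  is a distribution means that it is locally integrable.\<close>

definition weak_solution ::
  "real \<Rightarrow> (real \<Rightarrow> real \<Rightarrow> real) \<Rightarrow> (real \<times> real) set \<Rightarrow> real \<Rightarrow> real \<Rightarrow> (real \<Rightarrow> real) \<Rightarrow> bool" where
  "weak_solution \<gamma> f Dom c S v \<longleftrightarrow>
     v \<in> L1_loc S \<and>
     (AE t in lebesgue. t \<in> {0..<S} \<longrightarrow> (t, v t) \<in> Dom) \<and>
     (\<lambda>t. f t (v t)) \<in> L1_loc S \<and>
     dist_eq S (caputo \<gamma> c v) (regular_dist (zero_ext (\<lambda>t. f t (v t))))"

definition strong_solution ::
  "real \<Rightarrow> (real \<Rightarrow> real \<Rightarrow> real) \<Rightarrow> (real \<times> real) set \<Rightarrow> real \<Rightarrow> real \<Rightarrow> (real \<Rightarrow> real) \<Rightarrow> bool" where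
  "strong_solution \<gamma> f Dom c S v \<longleftrightarrow>
     weak_solution \<gamma> f Dom c S v \<and>
     v \<in> X_space S \<and> initial_value v = c \<and>
     (\<lambda>t. f t (v t)) \<in> L1_loc S \<and>
     (\<exists>h\<in>L1_loc S. dist_eq S (caputo \<gamma> c v) (regular_dist (zero_ext h)) \<and>
        (AE t in lebesgue. t \<in> {0..<S} \<longrightarrow> h t = f t (v t)))"

text \<open>Solutions are identified when they agree almost everywhere.\<close>

definition unique_strong_solution ::
  "real \<Rightarrow> (real \<Rightarrow> real \<Rightarrow> real) \<Rightarrow> (real \<times> real) set \<Rightarrow> real \<Rightarrow> real \<Rightarrow> (real \<Rightarrow> real) \<Rightarrow> bool" where
  "unique_strong_solution \<gamma> f Dom c S v \<longleftrightarrow>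
     strong_solution \<gamma> f Dom c S v \<and>
     (\<forall>w. strong_solution \<gamma> f Dom c S w \<longrightarrow> (AE t in lebesgue. t \<in> {0..<S} \<longrightarrow> w t = v t))"

definition mittag_leffler :: "real \<Rightarrow> real \<Rightarrow> real" where
  "mittag_leffler \<gamma> z = (\<Sum>n. z ^ n / Gamma (real n * \<gamma> + 1))"

text \<open>The supremum is taken in the extended reals, since it is infinite when \<open>M = 0\<close>.\<close>

definition existence_time :: "real \<Rightarrow> real \<Rightarrow> real \<Rightarrow> real \<Rightarrow> real \<Rightarrow> real" where
  "existence_time \<gamma> T A L M =
     real_of_ereal (min (ereal T)
       (SUP t\<in>{t. 0 \<le> t \<and>
             M / Gamma (1 + \<gamma>) * t powr \<gamma> * mittag_leffler \<gamma> (L * t powr \<gamma>) \<le> A}. ereal t))"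

end

(* Convolution with g_kernel gives the fractional integrals I_a, which satisfy I_a I_b = I_(a+b) on
   bounded functions (Beta integral and Fubini). The initial value problem is equivalent to the Volterra
   equation v = v0 + I_gamma f(., v(.)). A continuous solution of the Volterra equation solves the
   distributional equation by integration by parts. Conversely, testing the equation against smooth
   approximations of the ramp t |-> max (b - t) 0 and passing to the limit yields
   I_(2-gamma) v (b) = v0 g_(3-gamma)(b) + I_2 f(., v(.))(b) for every b; applying I_gamma, both sides of the
   Volterra equation have the same I_2, so they agree almost everywhere. After extending f by clamping
   its arguments, an iterate of the Volterra operator is a contraction, because n iterations cost the
   factor L^n t^(n gamma) / Gamma(n gamma + 1), the n-th Mittag-Leffler term. The same terms, summed,
   give a Gronwall inequality, hence uniqueness, the bound on |v - v0| that defines T1, and the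
   continuity in the initial value. *)

theory Submission
  imports Defs "HOL-Computational_Algebra.Polynomial"
begin

section \<open>Fractional integrals\<close>

text \<open>The obstacle is regularity: a competing solution is only a Lebesgue measurable function
  with values in \<open>Dom\<close> almost everywhere. Since \<open>Dom\<close> is bounded, it has a
  bounded Borel representative, and so has the right-hand side along it; this is why a calculus of
  fractional integrals of bounded Borel functions is enough. Testing with a ramp rather than a step
  costs one more integration, but the derivative of a smoothed ramp stays bounded uniformly in the
  approximation, so dominated convergence applies to the term with \<open>J_primitive\<close>; the
  derivative of a smoothed step would concentrate at \<open>b\<close>. Time is never cut into short
  steps: the clamped equation is solved on all of [0,T] at once, and T1 enters only afterwards, as a
  time before which the solution stays in \<open>Dom\<close>. Dependence on the initial value needs
  some room: strictly before T1 the growth bound is strictly below \<open>A\<close>, so a slightly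
  perturbed solution stays in \<open>Dom\<close> as well.\<close>

lemma g_kernel_measurable [measurable]: "g_kernel a \<in> borel_measurable borel"
  unfolding g_kernel_def by measurable

lemma g_kernel_nonneg: "0 < a \<Longrightarrow> 0 \<le> g_kernel a t"
  by (auto simp: g_kernel_def Gamma_real_pos less_imp_le)

lemma g_kernel_nonpos_eq_0 [simp]: "t \<le> 0 \<Longrightarrow> g_kernel a t = 0"
  by (simp add: g_kernel_def)

lemma g_kernel_1: "g_kernel 1 t = indicator {0<..} t"
  by (simp add: g_kernel_def indicator_def)

lemma g_kernel_2: "0 \<le> t \<Longrightarrow> g_kernel 2 t = t"
  using Gamma_fact[of 1, where 'a = real] by (simp add: g_kernel_def)

lemma g_kernel_mono:
  assumes "1 \<le> a" "s \<le> t" shows "g_kernel a s \<le> g_kernel a t"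
  using assms by (auto simp: g_kernel_def intro!: divide_right_mono powr_mono2 Gamma_real_nonneg)

text \<open>The substitution \<open>s = r + (t - r) * x\<close> turns the integral into a Beta
  integral over [0,1]. With the nonnegative integral, integrability near the possible singularities
  \<open>s = r\<close> and \<open>s = t\<close> comes together with the value.\<close>

lemma nn_integral_g_kernel_conv:
  assumes "0 < a" "0 < b"
  shows "(\<integral>\<^sup>+s. ennreal (g_kernel a (t - s) * g_kernel b (s - r)) \<partial>lborel) = ennreal (g_kernel (a + b) (t - r))"
proof (cases "r < t")
  case False
  have z: "g_kernel a (t - s) * g_kernel b (s - r) = 0" for s
    using False by (cases "s < t") auto
  then show ?thesis using False by (simp only: z ennreal_0 nn_integral_const) simp
next
  case True
  define c where "c = (t - r) powr (a + b - 2) / (Gamma a * Gamma b)"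
  have c: "0 \<le> c" using assms by (auto simp: c_def Gamma_real_pos less_imp_le)
  have G: "Gamma a > 0" "Gamma b > 0" "Gamma (a + b) > 0"
    using assms by (auto intro!: Gamma_real_pos)
  define B where "B x = x powr (b - 1) * (1 - x) powr (a - 1)" for x :: real
  have eq: "g_kernel a (t - (r + (t - r) * x)) * g_kernel b (r + (t - r) * x - r)
      = c * (B x * indicator {0..1} x)" if "x \<noteq> 0" "x \<noteq> 1" for x
  proof (cases "0 < x \<and> x < 1")
    case x: True
    have e: "t - (r + (t - r) * x) = (t - r) * (1 - x)" "r + (t - r) * x - r = (t - r) * x" by (simp_all add: algebra_simps)
    have "(t - r) powr (a - 1) * (t - r) powr (b - 1) = (t - r) powr (a + b - 2)"
      by (simp add: powr_add[symmetric])
    then have "((t - r) * (1 - x)) powr (a - 1) * ((t - r) * x) powr (b - 1)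
        = (t - r) powr (a + b - 2) * (x powr (b - 1) * (1 - x) powr (a - 1))"
      using x True by (simp add: powr_mult mult_ac)
    then show ?thesis using x True unfolding e
      by (simp add: g_kernel_def c_def B_def)
  next
    case x: False
    then have "x < 0 \<or> x > 1" using that by auto
    moreover have "r + (t - r) * x \<ge> t" if "x > 1"
      using mult_strict_left_mono[OF that, of "t - r"] True by (smt (verit))
    ultimately show ?thesis using True
      by (auto simp: mult_nonneg_nonpos)
  qed
  have "(\<integral>\<^sup>+s. ennreal (g_kernel a (t - s) * g_kernel b (s - r)) \<partial>lborel)
     = ennreal \<bar>t - r\<bar> * (\<integral>\<^sup>+x. ennreal (g_kernel a (t - (r + (t - r) * x)) * g_kernel b (r + (t - r) * x - r)) \<partial>lborel)"
    using True by (subst nn_integral_real_affine[where c = "t - r" and t = r]) auto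
  also have "(\<integral>\<^sup>+x. ennreal (g_kernel a (t - (r + (t - r) * x)) * g_kernel b (r + (t - r) * x - r)) \<partial>lborel)
     = (\<integral>\<^sup>+x. ennreal (c * (B x * indicator {0..1} x)) \<partial>lborel)"
  proof (rule nn_integral_cong_AE)
    show "AE x in lborel. ennreal (g_kernel a (t - (r + (t - r) * x)) * g_kernel b (r + (t - r) * x - r))
        = ennreal (c * (B x * indicator {0..1} x))"
      using AE_lborel_singleton[of 0] AE_lborel_singleton[of 1]
    proof eventually_elim
      case (elim x)
      show ?case by (rule arg_cong[OF eq[OF elim]])
    qed
  qed
  also have "\<dots> = (\<integral>\<^sup>+x. ennreal c * ennreal (B x * indicator {0..1} x) \<partial>lborel)"
    using c by (simp only: ennreal_mult')
  also have "\<dots> = ennreal c * (\<integral>\<^sup>+x. ennreal (B x * indicator {0..1} x) \<partial>lborel)"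
    unfolding B_def by (subst nn_integral_cmult) auto
  also have "(\<integral>\<^sup>+x. ennreal (B x * indicator {0..1} x) \<partial>lborel) = ennreal (Beta b a)"
  proof (rule nn_integral_has_integral_lborel)
    have "((\<lambda>x. if x \<in> {0..1} then B x else 0) has_integral Beta b a) UNIV"
      unfolding has_integral_restrict_UNIV using has_integral_Beta_real[OF assms(2,1)] by (simp add: B_def)
    moreover have "(\<lambda>x. if x \<in> {0..1} then B x else 0) = (\<lambda>x. B x * indicator {0..1} x)"
      by (auto split: split_indicator)
    ultimately show "((\<lambda>x. B x * indicator {0..1} x) has_integral Beta b a) UNIV" by simp
  qed (auto simp: B_def)
  also have "ennreal \<bar>t - r\<bar> * (ennreal c * ennreal (Beta b a)) = ennreal ((t - r) * (c * Beta b a))"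
    using True c by (simp add: ennreal_mult'[symmetric])
  also have "(t - r) * (c * Beta b a) = (t - r) * (t - r) powr (a + b - 2) / Gamma (a + b)"
    using G by (simp add: c_def Beta_def add.commute)
  also have "\<dots> = g_kernel (a + b) (t - r)"
    using True by (simp add: g_kernel_def powr_mult_base)
  finally show ?thesis .
qed

lemma has_bochner_integral_g_kernel_conv:
  assumes "0 < a" "0 < b"
  shows "has_bochner_integral lborel (\<lambda>s. g_kernel a (t - s) * g_kernel b (s - r)) (g_kernel (a + b) (t - r))"
  using assms nn_integral_g_kernel_conv[OF assms]
  by (intro has_bochner_integral_nn_integral) (auto simp: g_kernel_nonneg)

text \<open>Both cut-offs sit in the integrand: the kernel vanishes for \<open>s \<ge> t\<close>,
  the indicator for \<open>s \<le> 0\<close>. As the domain of integration does not depend on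
  \<open>t\<close>, measurability in \<open>t\<close> and Fubini apply directly.\<close>

definition frac_int :: "real \<Rightarrow> (real \<Rightarrow> real) \<Rightarrow> real \<Rightarrow> real" where
  "frac_int a h t = (LINT s|lborel. g_kernel a (t - s) * (indicator {0<..} s * h s))"

lemma frac_int_measurable [measurable]:
  assumes [measurable]: "h \<in> borel_measurable borel"
  shows "frac_int a h \<in> borel_measurable borel"
  unfolding frac_int_def[abs_def] by measurable

lemma has_bochner_integral_frac_const:
  assumes "0 < a"
  shows "has_bochner_integral lborel (\<lambda>s. g_kernel a (t - s) * (indicator {0<..} s * c)) (c * g_kernel (a + 1) t)"
  using has_bochner_integral_mult_right[OF has_bochner_integral_g_kernel_conv[OF assms zero_less_one, of t 0], of c]
  by (simp add: g_kernel_1 mult_ac)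

section \<open>Integrability, monotonicity and linearity of fractional integrals\<close>

lemma frac_int_integrable:
  assumes "0 < a" and [measurable]: "h \<in> borel_measurable borel"
    and h: "\<And>s. 0 < s \<Longrightarrow> s < t \<Longrightarrow> \<bar>h s\<bar> \<le> K"
  shows "integrable lborel (\<lambda>s. g_kernel a (t - s) * (indicator {0<..} s * h s))"
proof (rule Bochner_Integration.integrable_bound)
  show "integrable lborel (\<lambda>s. g_kernel a (t - s) * (indicator {0<..} s * K))"
    using has_bochner_integral_frac_const[OF assms(1), of t K] by (auto simp: has_bochner_integral_iff)
  show "AE s in lborel. norm (g_kernel a (t - s) * (indicator {0<..} s * h s))
      \<le> norm (g_kernel a (t - s) * (indicator {0<..} s * K))"
  proof (intro AE_I2)
    fix s
    show "norm (g_kernel a (t - s) * (indicator {0<..} s * h s)) \<le> norm (g_kernel a (t - s) * (indicator {0<..} s * K))"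
    proof (cases "0 < s \<and> s < t")
      case True
      then show ?thesis
        using h[of s] by (auto simp: abs_mult intro!: mult_left_mono)
    qed (auto split: split_indicator)
  qed
qed measurable

lemma frac_int_cong:
  assumes "AE s in lborel. 0 < s \<and> s < t \<longrightarrow> h s = k s"
    and [measurable]: "h \<in> borel_measurable borel" "k \<in> borel_measurable borel"
  shows "frac_int a h t = frac_int a k t"
  unfolding frac_int_def
proof (rule integral_cong_AE)
  show "AE s in lborel. g_kernel a (t - s) * (indicator {0<..} s * h s) = g_kernel a (t - s) * (indicator {0<..} s * k s)"
    using assms(1)
  proof eventually_elim
    case (elim s)
    then show ?case by (cases "s < t") (auto split: split_indicator)
  qed
qed measurable

lemma frac_int_mono:
  assumes "0 < a" "h \<in> borel_measurable borel" "k \<in> borel_measurable borel"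
    and "\<And>s. 0 < s \<Longrightarrow> s < t \<Longrightarrow> \<bar>h s\<bar> \<le> K" "\<And>s. 0 < s \<Longrightarrow> s < t \<Longrightarrow> \<bar>k s\<bar> \<le> K'"
    and le: "\<And>s. 0 < s \<Longrightarrow> s < t \<Longrightarrow> h s \<le> k s"
  shows "frac_int a h t \<le> frac_int a k t"
  unfolding frac_int_def
proof (rule integral_mono)
  fix s
  show "g_kernel a (t - s) * (indicator {0<..} s * h s) \<le> g_kernel a (t - s) * (indicator {0<..} s * k s)"
  proof (cases "0 < s \<and> s < t")
    case True
    then show ?thesis
      using le[of s] g_kernel_nonneg[OF assms(1), of "t - s"] by (auto intro!: mult_left_mono)
  qed (auto split: split_indicator)
qed (rule frac_int_integrable[OF assms(1)]; use assms in blast)+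

lemma frac_int_add:
  assumes "0 < a" "h \<in> borel_measurable borel" "k \<in> borel_measurable borel"
    and "\<And>s. 0 < s \<Longrightarrow> s < t \<Longrightarrow> \<bar>h s\<bar> \<le> K" "\<And>s. 0 < s \<Longrightarrow> s < t \<Longrightarrow> \<bar>k s\<bar> \<le> K'"
  shows "frac_int a (\<lambda>s. h s + k s) t = frac_int a h t + frac_int a k t"
  unfolding frac_int_def
  by (subst Bochner_Integration.integral_add[symmetric])
     (auto simp: ring_distribs intro: frac_int_integrable assms)

lemma frac_int_cmult: "frac_int a (\<lambda>s. c * h s) t = c * frac_int a h t"
proof -
  have "(\<lambda>s. g_kernel a (t - s) * (indicator {0<..} s * (c * h s)))
    = (\<lambda>s. c * (g_kernel a (t - s) * (indicator {0<..} s * h s)))" by (auto simp: mult_ac)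
  then show ?thesis unfolding frac_int_def by simp
qed

lemma frac_int_diff:
  assumes "0 < a" "h \<in> borel_measurable borel" "k \<in> borel_measurable borel"
    and "\<And>s. 0 < s \<Longrightarrow> s < t \<Longrightarrow> \<bar>h s\<bar> \<le> K" "\<And>s. 0 < s \<Longrightarrow> s < t \<Longrightarrow> \<bar>k s\<bar> \<le> K'"
  shows "frac_int a (\<lambda>s. h s - k s) t = frac_int a h t - frac_int a k t"
  unfolding frac_int_def
  by (subst Bochner_Integration.integral_diff[symmetric])
     (auto simp: ring_distribs intro: frac_int_integrable assms)

lemma frac_int_const: "0 < a \<Longrightarrow> frac_int a (\<lambda>_. c) t = c * g_kernel (a + 1) t"
  using has_bochner_integral_frac_const by (auto simp: has_bochner_integral_iff frac_int_def)

lemma frac_int_g_kernel: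
  assumes "0 < a" "0 < b" shows "frac_int a (g_kernel b) t = g_kernel (a + b) t"
proof -
  have "indicator {0<..} s * g_kernel b s = g_kernel b s" for s
    by (cases "0 < s") auto
  then show ?thesis unfolding frac_int_def
    using has_bochner_integral_g_kernel_conv[OF assms, of t 0]
    by (simp only: has_bochner_integral_iff diff_0_right)
qed

lemma frac_int_nonpos [simp]: "t \<le> 0 \<Longrightarrow> frac_int a h t = 0"
proof -
  assume t: "t \<le> 0"
  have "g_kernel a (t - s) * (indicator {0<..} s * h s) = 0" for s
    using t by (cases "0 < s") auto
  then show ?thesis unfolding frac_int_def by (simp only: integral_zero)
qed

lemma abs_frac_int_le:
  assumes "0 < a" and [measurable]: "h \<in> borel_measurable borel" "k \<in> borel_measurable borel"
    and k: "\<And>s. 0 < s \<Longrightarrow> s < t \<Longrightarrow> \<bar>h s\<bar> \<le> k s" "\<And>s. 0 < s \<Longrightarrow> s < t \<Longrightarrow> k s \<le> K"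
  shows "\<bar>frac_int a h t\<bar> \<le> frac_int a k t"
proof -
  have "frac_int a h t \<le> frac_int a k t"
    by (rule frac_int_mono[where K=K and K'=K]) (use assms in \<open>auto; smt (verit)\<close>)+
  moreover have "frac_int a (\<lambda>s. -1 * h s) t \<le> frac_int a k t"
    by (rule frac_int_mono[where K=K and K'=K]) (use assms in \<open>auto; smt (verit)\<close>)+
  ultimately show ?thesis unfolding frac_int_cmult by simp
qed

text \<open>Tonelli comes first: for fixed \<open>r\<close>, integrating
  \<open>\<bar>F r s\<bar>\<close> over \<open>s\<close> gives
  \<open>g_kernel (a + b) (t - r) * \<bar>z r\<bar>\<close>, which is integrable because
  \<open>h\<close> is bounded on (0,t). After the exchange the inner integral is the convolution of
  the two kernels.\<close>

lemma frac_int_frac_int: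
  assumes "0 < a" "0 < b" and [measurable]: "h \<in> borel_measurable borel"
    and h: "\<And>s. 0 < s \<Longrightarrow> s < t \<Longrightarrow> \<bar>h s\<bar> \<le> K"
  shows "frac_int a (frac_int b h) t = frac_int (a + b) h t"
proof -
  define z where "z r = indicator {0<..} r * h r" for r
  have [measurable]: "z \<in> borel_measurable borel" unfolding z_def[abs_def] by measurable
  define F where "F r s = g_kernel a (t - s) * g_kernel b (s - r) * z r" for r s
  have [measurable]: "(\<lambda>(r, s). F r s) \<in> borel_measurable (lborel \<Otimes>\<^sub>M lborel)"
    unfolding F_def by measurable
  have hb: "has_bochner_integral lborel (F r) (g_kernel (a + b) (t - r) * z r)" for r
    unfolding F_def by (intro has_bochner_integral_mult_left has_bochner_integral_g_kernel_conv assms)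
  have int: "integrable (lborel \<Otimes>\<^sub>M lborel) (\<lambda>(r, s). F r s)"
  proof (rule integrableI_bounded)
    have "(\<integral>\<^sup>+x. ennreal (norm (case x of (r, s) \<Rightarrow> F r s)) \<partial>(lborel \<Otimes>\<^sub>M lborel))
       = (\<integral>\<^sup>+r. \<integral>\<^sup>+s. ennreal (norm (F r s)) \<partial>lborel \<partial>lborel)"
      by (subst lborel.nn_integral_fst[symmetric]) auto
    also have "\<dots> = (\<integral>\<^sup>+r. ennreal (norm (g_kernel (a + b) (t - r) * z r)) \<partial>lborel)"
    proof (rule nn_integral_cong)
      fix r
      have "(\<integral>\<^sup>+s. ennreal (norm (F r s)) \<partial>lborel)
        = (\<integral>\<^sup>+s. ennreal (g_kernel a (t - s) * g_kernel b (s - r)) * ennreal \<bar>z r\<bar> \<partial>lborel)"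
        using assms by (intro nn_integral_cong) (simp add: F_def abs_mult ennreal_mult' g_kernel_nonneg)
      also have "\<dots> = ennreal (g_kernel (a + b) (t - r)) * ennreal \<bar>z r\<bar>"
        using assms by (subst nn_integral_multc) (auto simp: nn_integral_g_kernel_conv)
      finally show "(\<integral>\<^sup>+s. ennreal (norm (F r s)) \<partial>lborel) = ennreal (norm (g_kernel (a + b) (t - r) * z r))"
        using assms by (simp add: abs_mult ennreal_mult' g_kernel_nonneg)
    qed
    also have "\<dots> < \<infinity>"
      using frac_int_integrable[of "a + b" h t K] assms
      unfolding integrable_iff_bounded z_def by auto
    finally show "(\<integral>\<^sup>+x. ennreal (norm (case x of (r, s) \<Rightarrow> F r s)) \<partial>(lborel \<Otimes>\<^sub>M lborel)) < \<infinity>" .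
  qed measurable
  have "frac_int a (frac_int b h) t = (LINT s|lborel. LINT r|lborel. F r s)"
    unfolding frac_int_def[of a]
  proof (rule Bochner_Integration.integral_cong)
    fix s
    have "indicator {0<..} s * frac_int b h s = frac_int b h s"
      by (auto split: split_indicator)
    then show "g_kernel a (t - s) * (indicator {0<..} s * frac_int b h s) = (LINT r|lborel. F r s)"
      by (simp add: frac_int_def F_def z_def mult.assoc)
  qed simp
  also have "\<dots> = (LINT r|lborel. LINT s|lborel. F r s)"
    by (rule lborel_pair.Fubini_integral[OF int])
  also have "\<dots> = frac_int (a + b) h t"
    using hb by (simp add: has_bochner_integral_iff frac_int_def z_def)
  finally show ?thesis .
qed

text \<open>The difference is at most \<open>K\<close> times the L1 distance of the two kernels,
  which convolution with \<open>g_kernel 1\<close> evaluates exactly. Of that value only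
  \<open>2 * g_kernel (a + 1) (t - t0)\<close> survives, as the other two terms have a nonpositive
  sum.\<close>

lemma frac_int_holder:
  assumes "0 < a" "a \<le> 1" and [measurable]: "h \<in> borel_measurable borel"
    and K: "\<And>s. 0 < s \<Longrightarrow> s < t \<Longrightarrow> \<bar>h s\<bar> \<le> K" and t: "t' \<le> t" and K0: "0 \<le> K"
  shows "\<bar>frac_int a h t - frac_int a h t'\<bar> \<le> 2 * K * g_kernel (a + 1) (t - t')"
proof (cases "0 < t")
  case False
  then show ?thesis using t K0 assms(1) by (auto simp: g_kernel_nonneg)
next
  case tpos: True
  \<comment> \<open>For \<open>t' < 0\<close> the integral vanishes just as at 0, and
    \<open>0 \<le> t0\<close> makes \<open>Q\<close> vanish for \<open>s \<le> 0\<close>.\<close>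
  define t0 where "t0 = max 0 t'"
  have t0: "0 \<le> t0" "t0 \<le> t" "t' \<le> t0" using t tpos by (auto simp: t0_def)
  have eqt: "frac_int a h t' = frac_int a h t0" by (cases "t' \<le> 0") (auto simp: t0_def)
  \<comment> \<open>\<open>g_kernel a\<close> decreases, so for \<open>0 < s \<noteq> t0\<close> the function \<open>Q\<close> is the absolute value of the difference of
    the two kernels.\<close>
  define Q where "Q s = g_kernel a (t0 - s) * g_kernel 1 s - g_kernel a (t - s) * g_kernel 1 s
      + 2 * (g_kernel a (t - s) * g_kernel 1 (s - t0))" for s
  have Q: "has_bochner_integral lborel Q (g_kernel (a + 1) (t0 - 0) - g_kernel (a + 1) (t - 0) + 2 * g_kernel (a + 1) (t - t0))"
    unfolding Q_def
    using has_bochner_integral_g_kernel_conv[OF assms(1) zero_less_one, of _ 0]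
       has_bochner_integral_g_kernel_conv[OF assms(1) zero_less_one]
    by (intro has_bochner_integral_add has_bochner_integral_diff has_bochner_integral_mult_right) auto
  have i1: "integrable lborel (\<lambda>s. g_kernel a (t - s) * (indicator {0<..} s * h s))"
    by (rule frac_int_integrable) (use assms in auto)
  have i2: "integrable lborel (\<lambda>s. g_kernel a (t0 - s) * (indicator {0<..} s * h s))"
    by (rule frac_int_integrable[where K=K]) (use assms t0 in auto)
  have "norm (frac_int a h t - frac_int a h t0)
    \<le> (LINT s|lborel. K * Q s)"
    unfolding frac_int_def
  proof (subst Bochner_Integration.integral_diff[OF i1 i2, symmetric], rule order_trans[OF integral_norm_bound integral_mono_AE])
    show "integrable lborel (\<lambda>s. K * Q s)" using Q by (auto simp: has_bochner_integral_iff)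
    show "integrable lborel (\<lambda>s. norm (g_kernel a (t - s) * (indicator {0<..} s * h s) - g_kernel a (t0 - s) * (indicator {0<..} s * h s)))"
      using i1 i2 by auto
    show "AE s in lborel. norm (g_kernel a (t - s) * (indicator {0<..} s * h s) - g_kernel a (t0 - s) * (indicator {0<..} s * h s)) \<le> K * Q s"
      using AE_lborel_singleton[of t0]
    proof eventually_elim
      case (elim s)
      let ?l = "norm (g_kernel a (t - s) * (indicator {0<..} s * h s) - g_kernel a (t0 - s) * (indicator {0<..} s * h s))"
      consider "s \<le> 0" | "0 < s" "s < t0" | "0 < s" "t0 < s" "s < t" | "0 < s" "t \<le> s" using elim by linarith
      then show ?case
      proof cases
        case 1
        then show ?thesis using t0 by (simp add: Q_def g_kernel_1)
      next
        case 2
        have "g_kernel a (t - s) \<le> g_kernel a (t0 - s)"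
          using 2 t0 assms by (auto simp: g_kernel_def intro!: divide_right_mono powr_mono2' Gamma_real_nonneg)
        moreover have "?l = \<bar>g_kernel a (t - s) - g_kernel a (t0 - s)\<bar> * \<bar>h s\<bar>"
          using 2 by (simp add: abs_mult[symmetric] left_diff_distrib)
        ultimately have "?l \<le> (g_kernel a (t0 - s) - g_kernel a (t - s)) * K"
          using K[of s] 2 t0 by (auto intro!: mult_mono)
        then show ?thesis using 2 by (simp add: Q_def g_kernel_1 mult_ac)
      next
        case 3
        then show ?thesis using K[of s] g_kernel_nonneg[OF assms(1), of "t - s"]
          by (auto simp: Q_def g_kernel_1 abs_mult mult_ac intro!: mult_right_mono)
      next
        case 4
        then show ?thesis using t0 by (simp add: Q_def)
      qed
    qed
  qed
  also have "\<dots> = K * (g_kernel (a + 1) t0 - g_kernel (a + 1) t + 2 * g_kernel (a + 1) (t - t0))"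
    using Q by (auto simp: has_bochner_integral_iff)
  also have "\<dots> \<le> K * (2 * g_kernel (a + 1) (t - t'))"
    using g_kernel_mono[of "a + 1" t0 t] g_kernel_mono[of "a + 1" "t - t0" "t - t'"] assms t0 K0
    by (intro mult_left_mono) auto
  finally show ?thesis unfolding eqt by (simp add: mult_ac)
qed

section \<open>Mittag-Leffler function and Gronwall inequality\<close>

lemma frac_int_continuous_on:
  assumes "0 < a" "a \<le> 1" and [measurable]: "h \<in> borel_measurable borel"
    and K: "\<And>s. 0 < s \<Longrightarrow> s < T \<Longrightarrow> \<bar>h s\<bar> \<le> K"
  shows "continuous_on {..T} (frac_int a h)"
proof (cases "0 < T")
  case False
  then have "frac_int a h t = 0" if "t \<in> {..T}" for t using that by simp
  then show ?thesis by (metis continuous_on_cong continuous_on_const)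
next
  case T: True
  have K0: "0 \<le> K" using K[of "T/2"] T by linarith
  show ?thesis unfolding continuous_on_def
  proof
    fix x assume x: "x \<in> {..T}"
    have "((\<lambda>t. \<bar>t - x\<bar> powr a) \<longlongrightarrow> \<bar>x - x\<bar> powr a) (at x within {..T})"
      using assms by (intro tendsto_powr' tendsto_intros) auto
    then have "((\<lambda>t. 2 * K * (\<bar>t - x\<bar> powr a / Gamma (a + 1))) \<longlongrightarrow> 2 * K * (0 / Gamma (a + 1))) (at x within {..T})"
      using less_imp_neq[OF Gamma_real_pos[of "a + 1"]] assms(1) by (intro tendsto_intros) auto
    then have lim: "((\<lambda>t. 2 * K * g_kernel (a + 1) \<bar>t - x\<bar>) \<longlongrightarrow> 0) (at x within {..T})"
      using assms(1) by (auto simp: g_kernel_def elim!: Lim_transform_eventually intro!: always_eventually)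
    have "\<forall>\<^sub>F t in at x within {..T}. norm (frac_int a h t - frac_int a h x) \<le> 2 * K * g_kernel (a + 1) \<bar>t - x\<bar>"
      unfolding eventually_at_filter
    proof (intro always_eventually allI impI)
      fix t assume t: "t \<in> {..T}"
      show "norm (frac_int a h t - frac_int a h x) \<le> 2 * K * g_kernel (a + 1) \<bar>t - x\<bar>"
      proof (cases "x \<le> t")
        case True
        then show ?thesis using frac_int_holder[OF assms(1-3) _ True K0] K t by auto
      next
        case False
        then show ?thesis using frac_int_holder[OF assms(1-3) _ _ K0, of x t] K x
          by (auto simp: abs_minus_commute)
      qed
    qed
    then have "((\<lambda>t. frac_int a h t - frac_int a h x) \<longlongrightarrow> 0) (at x within {..T})"
      by (rule Lim_null_comparison[OF _ lim])
    then show "(frac_int a h \<longlongrightarrow> frac_int a h x) (at x within {..T})"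
      by (simp add: LIM_zero_iff)
  qed
qed

lemma frac_int_1:
  assumes [measurable]: "h \<in> borel_measurable borel"
    and K: "\<And>s. 0 < s \<Longrightarrow> s < t \<Longrightarrow> \<bar>h s\<bar> \<le> K"
  shows "h integrable_on {0..t}" "frac_int 1 h t = integral {0..t} h"
proof -
  have e: "g_kernel 1 (t - s) * (indicator {0<..} s * h s) = indicator {0<..<t} s *\<^sub>R h s" for s
    by (auto simp: g_kernel_1 split: split_indicator)
  have i: "set_integrable lborel {0<..<t} h"
    using frac_int_integrable[of 1 h t K] K unfolding e set_integrable_def by simp
  show "h integrable_on {0..t}"
    using set_borel_integral_eq_integral(1)[OF i] by (simp add: integrable_on_Icc_iff_Ioo)
  show "frac_int 1 h t = integral {0..t} h"
    using set_borel_integral_eq_integral(2)[OF i]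
    by (simp add: frac_int_def e set_lebesgue_integral_def integral_open_interval_real)
qed

lemma frac_int_1_has_derivative:
  assumes c: "continuous_on UNIV h" and "0 < t"
  shows "(frac_int 1 h has_real_derivative h t) (at t)"
proof -
  have m: "h \<in> borel_measurable borel" using c by (rule borel_measurable_continuous_onI)
  have eq: "frac_int 1 h x = integral {0..x} h" if "0 < x" for x
  proof -
    have "compact (h ` {0..x})" by (intro compact_continuous_image continuous_on_subset[OF c]) auto
    then obtain K where "\<And>s. s \<in> {0..x} \<Longrightarrow> \<bar>h s\<bar> \<le> K"
      by (force dest!: compact_imp_bounded simp: bounded_iff)
    then show ?thesis by (intro frac_int_1[OF m, of _ K]) auto
  qed
  have "((\<lambda>x. integral {0..x} h) has_real_derivative h t) (at t within {0..t + 1})"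
    by (rule integral_has_real_derivative) (use assms in \<open>auto intro: continuous_on_subset\<close>)
  then have "((\<lambda>x. integral {0..x} h) has_real_derivative h t) (at t within {0<..<t + 1})"
    by (rule has_field_derivative_subset) auto
  then have "((\<lambda>x. integral {0..x} h) has_real_derivative h t) (at t)"
    using assms(2) at_within_open[of t "{0<..<t + 1}"] by simp
  then show ?thesis
    by (rule has_field_derivative_transform_within_open[where S = "{0<..}"]) (use assms eq in auto)
qed

text \<open>Only the part of the Gamma integral beyond \<open>R\<close> is kept, where
  \<open>t powr x\<close> is at least \<open>R powr x\<close>. Since \<open>R\<close> is arbitrary,
  Gamma outgrows every geometric sequence, so the Mittag-Leffler series converges for every
  argument.\<close>

lemma Gamma_ge_powr_exp:
  assumes "0 \<le> x" "0 < R"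
  shows "R powr x * exp (- R) \<le> Gamma (x + 1 :: real)"
proof -
  have "((\<lambda>t. R powr x * exp (- 1 * t)) has_integral R powr x * (exp (- 1 * R) / 1)) {R..}"
    by (intro has_integral_mult_right has_integral_exp_minus_to_infinity) auto
  then have "((\<lambda>t. if t \<in> {R..} then R powr x * exp (- t) else 0) has_integral R powr x * exp (- R)) {0..}"
    by (subst has_integral_restrict) (use assms in auto)
  moreover have "((\<lambda>t. t powr (x + 1 - 1) / exp t) has_integral Gamma (x + 1)) {0..}"
    by (rule Gamma_integral_real) (use assms in auto)
  ultimately show ?thesis
    by (rule has_integral_le) (use assms in \<open>auto simp: exp_minus field_simps intro!: powr_mono2\<close>)
qed

lemma summable_mittag_leffler:
  assumes "0 < \<gamma>"
  shows "summable (\<lambda>n. z ^ n / Gamma (real n * \<gamma> + 1))"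
proof -
  \<comment> \<open>\<open>R\<close> is chosen so that R^\<gamma> exceeds \<open>2 \<bar>z\<bar>\<close>, which makes the comparison series geometric.\<close>
  define R where "R = (2 * \<bar>z\<bar> + 1) powr (1 / \<gamma>)"
  have R: "0 < R" "R powr \<gamma> = 2 * \<bar>z\<bar> + 1" using assms by (auto simp: R_def powr_powr)
  have b: "\<bar>z ^ n / Gamma (real n * \<gamma> + 1)\<bar> \<le> exp R * (1 / 2) ^ n" for n
  proof -
    have "R powr (real n * \<gamma>) = (R powr \<gamma>) ^ n"
      using R by (simp add: powr_powr[symmetric] mult.commute powr_realpow)
    then have p: "(2 * \<bar>z\<bar> + 1) ^ n * exp (- R) \<le> Gamma (real n * \<gamma> + 1)"
      using Gamma_ge_powr_exp[of "real n * \<gamma>" R] assms R by simp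
    have p0: "0 < (2 * \<bar>z\<bar> + 1) ^ n * exp (- R)" by simp
    have "\<bar>z\<bar> ^ n * 2 ^ n \<le> (2 * \<bar>z\<bar> + 1) ^ n"
      unfolding power_mult_distrib[symmetric] by (rule power_mono) auto
    then have "\<bar>z\<bar> ^ n / ((2 * \<bar>z\<bar> + 1) ^ n * exp (- R)) \<le> exp R * (1 / 2) ^ n"
      by (simp add: exp_minus field_simps)
    moreover have G: "0 < Gamma (real n * \<gamma> + 1)" using less_le_trans[OF p0 p] .
    moreover have "\<bar>z\<bar> ^ n / Gamma (real n * \<gamma> + 1) \<le> \<bar>z\<bar> ^ n / ((2 * \<bar>z\<bar> + 1) ^ n * exp (- R))"
      using p p0 G by (intro divide_left_mono mult_pos_pos) auto
    ultimately show ?thesis by (simp add: abs_divide power_abs)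
  qed
  show ?thesis
    by (rule summable_comparison_test'[where N = 0 and g = "\<lambda>n. exp R * (1 / 2) ^ n"])
       (use b in \<open>auto intro!: summable_mult summable_geometric\<close>)
qed

text \<open>\<open>x \<mapsto> ln (Gamma (x + 1))\<close> is convex and vanishes at \<open>0\<close>.\<close>

lemma Gamma_superadditive:
  assumes "0 \<le> a" "0 \<le> (b :: real)"
  shows "Gamma (a + 1) * Gamma (b + 1) \<le> Gamma (a + b + 1)"
proof (cases "a + b = 0")
  case True
  then have "a = 0" "b = 0" using assms by auto
  then show ?thesis by simp
next
  case False
  then have ab: "0 < a + b" using assms by simp
  \<comment> \<open>The chord of \<open>ln \<circ> Gamma\<close> from 1 to \<open>a + b + 1\<close>
    starts at height 0. It is used at \<open>a + 1\<close> and \<open>b + 1\<close>, whose weights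
    add up to 1.\<close>
  have conv: "ln (Gamma (c + 1)) \<le> c / (a + b) * ln (Gamma (a + b + 1))" if "0 \<le> c" "c \<le> a + b" for c
  proof -
    have "(ln \<circ> Gamma) ((1 - c / (a + b)) *\<^sub>R 1 + (c / (a + b)) *\<^sub>R (a + b + 1))
       \<le> (1 - c / (a + b)) * (ln \<circ> Gamma) 1 + c / (a + b) * (ln \<circ> Gamma) (a + b + 1)"
      using ab that by (intro convex_onD[OF log_convex_Gamma_real]) auto
    moreover have "(1 - c / (a + b)) *\<^sub>R 1 + (c / (a + b)) *\<^sub>R (a + b + 1) = c + 1"
    proof -
      define k where "k = c / (a + b)"
      have "k * (a + b) = c" using ab by (simp add: k_def)
      then have "(1 - k) *\<^sub>R 1 + k *\<^sub>R (a + b + 1) = c + 1" by (simp add: algebra_simps)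
      then show ?thesis by (simp only: k_def)
    qed
    ultimately show ?thesis unfolding comp_def by (simp only: Gamma_1 ln_one mult_zero_right add_0)
  qed
  have "ln (Gamma (a + 1)) + ln (Gamma (b + 1)) \<le> ln (Gamma (a + b + 1))"
  proof -
    have "a / (a + b) + b / (a + b) = 1" using ab by (simp add: add_divide_distrib[symmetric])
    then have "a / (a + b) * ln (Gamma (a + b + 1)) + b / (a + b) * ln (Gamma (a + b + 1)) = ln (Gamma (a + b + 1))"
      by (metis distrib_right mult_1)
    then show ?thesis using conv[of a] conv[of b] assms by linarith
  qed
  moreover have "0 < Gamma (a + 1)" "0 < Gamma (b + 1)" "0 < Gamma (a + b + 1)"
    using assms by (auto intro!: Gamma_real_pos)
  ultimately show ?thesis
    by (metis exp_le_cancel_iff exp_add exp_ln)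
qed

section \<open>Elementary bounds for the Mittag-Leffler series\<close>

lemma g_kernel_powr_power:
  assumes "0 < t"
  shows "L ^ n * g_kernel (real n * \<gamma> + 1) t = (L * t powr \<gamma>) ^ n / Gamma (real n * \<gamma> + 1)"
  using assms by (simp add: g_kernel_def power_mult_distrib powr_powr[symmetric] powr_realpow mult.commute[of "real n"])

lemma mittag_leffler_mono:
  assumes "0 < \<gamma>" "0 \<le> x" "x \<le> y"
  shows "mittag_leffler \<gamma> x \<le> mittag_leffler \<gamma> y"
  unfolding mittag_leffler_def
  using assms by (intro suminf_le summable_mittag_leffler divide_right_mono power_mono Gamma_real_nonneg) (auto intro: add_nonneg_pos)

lemma sum_le_mittag_leffler:
  assumes "0 < \<gamma>" "0 \<le> x"
  shows "(\<Sum>k<n. x ^ k / Gamma (real k * \<gamma> + 1)) \<le> mittag_leffler \<gamma> x"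
  unfolding mittag_leffler_def
  using assms by (intro sum_le_suminf summable_mittag_leffler) (auto intro!: divide_nonneg_nonneg Gamma_real_nonneg add_nonneg_pos)

lemma mittag_leffler_ge_1:
  assumes "0 < \<gamma>" "0 \<le> x"
  shows "1 \<le> mittag_leffler \<gamma> x"
  using sum_le_mittag_leffler[OF assms, of 1] by simp

text \<open>The inequality is substituted into itself \<open>n\<close> times. The sources become
  partial sums, and the crude bound \<open>K\<close> becomes a remainder that is a multiple of a
  Mittag-Leffler term and so tends to 0. The \<open>b\<close> term serves the growth estimate, whose
  source is \<open>M * g_kernel (\<gamma> + 1)\<close>.\<close>

lemma fractional_gronwall:
  assumes \<gamma>: "0 < \<gamma>" and L: "0 \<le> L" and a: "0 \<le> a" and b: "0 \<le> b"
    and [measurable]: "u \<in> borel_measurable borel"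
    and uK: "\<And>s. 0 < s \<Longrightarrow> s < S \<Longrightarrow> \<bar>u s\<bar> \<le> K"
    and u: "\<And>s. 0 < s \<Longrightarrow> s < S \<Longrightarrow> u s \<le> a + b * g_kernel (\<gamma> + 1) s + L * frac_int \<gamma> u s"
    and t: "0 < t" "t < S"
  shows "u t \<le> (a + b * g_kernel (\<gamma> + 1) t) * mittag_leffler \<gamma> (L * t powr \<gamma>)"
proof -
  define m where "m n = (L * t powr \<gamma>) ^ n / Gamma (real n * \<gamma> + 1)" for n
  \<comment> \<open>The bound after \<open>n\<close> substitutions, started from
    \<open>u s \<le> K\<close>.\<close>
  define B where "B n s = (\<Sum>k<n. L ^ k * (a * g_kernel (real k * \<gamma> + 1) s
      + b * g_kernel (real (Suc k) * \<gamma> + 1) s)) + K * L ^ n * g_kernel (real n * \<gamma> + 1) s" for n s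
  have [measurable]: "B n \<in> borel_measurable borel" for n unfolding B_def[abs_def] by measurable
  have K0: "0 \<le> K" using uK[of t] t by linarith
  have B_nonneg: "0 \<le> B n s" for n s
    unfolding B_def using assms K0
    by (intro add_nonneg_nonneg sum_nonneg mult_nonneg_nonneg g_kernel_nonneg) (auto intro: add_nonneg_pos)
  have B_mono: "B n r \<le> B n s" if "r \<le> s" for n r s
    unfolding B_def using assms K0 that
    by (intro add_mono sum_mono mult_left_mono g_kernel_mono) auto
  have fB: "frac_int \<gamma> (B n) s = (\<Sum>k<n. L ^ k * (a * g_kernel (real (Suc k) * \<gamma> + 1) s
      + b * g_kernel (real (Suc (Suc k)) * \<gamma> + 1) s)) + K * L ^ n * g_kernel (real (Suc n) * \<gamma> + 1) s" for n s
  proof -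
    have gk: "has_bochner_integral lborel (\<lambda>r. g_kernel \<gamma> (s - r) * g_kernel (real k * \<gamma> + 1) (r - 0)) (g_kernel (\<gamma> + (real k * \<gamma> + 1)) (s - 0))" for k
      by (intro has_bochner_integral_g_kernel_conv) (use \<gamma> in \<open>auto intro: add_nonneg_pos\<close>)
    have "has_bochner_integral lborel (\<lambda>r. (\<Sum>k<n. L ^ k * (a * (g_kernel \<gamma> (s - r) * g_kernel (real k * \<gamma> + 1) (r - 0))
       + b * (g_kernel \<gamma> (s - r) * g_kernel (real (Suc k) * \<gamma> + 1) (r - 0))))
       + K * L ^ n * (g_kernel \<gamma> (s - r) * g_kernel (real n * \<gamma> + 1) (r - 0)))
      ((\<Sum>k<n. L ^ k * (a * g_kernel (\<gamma> + (real k * \<gamma> + 1)) (s - 0)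
      + b * g_kernel (\<gamma> + (real (Suc k) * \<gamma> + 1)) (s - 0))) + K * L ^ n * g_kernel (\<gamma> + (real n * \<gamma> + 1)) (s - 0))"
      by (intro has_bochner_integral_add has_bochner_integral_sum has_bochner_integral_mult_right gk)
    moreover have "g_kernel \<gamma> (s - r) * (indicator {0<..} r * B n r) =
       (\<Sum>k<n. L ^ k * (a * (g_kernel \<gamma> (s - r) * g_kernel (real k * \<gamma> + 1) (r - 0))
       + b * (g_kernel \<gamma> (s - r) * g_kernel (real (Suc k) * \<gamma> + 1) (r - 0))))
       + K * L ^ n * (g_kernel \<gamma> (s - r) * g_kernel (real n * \<gamma> + 1) (r - 0))" for r
      by (cases "0 < r") (simp_all add: B_def distrib_left sum_distrib_left mult_ac)
    ultimately show ?thesis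
      unfolding frac_int_def has_bochner_integral_iff by (simp add: algebra_simps)
  qed
  have main: "u s \<le> B n s" if "0 < s" "s < S" for n s
    using that
  proof (induction n arbitrary: s)
    case 0
    then show ?case using uK[of s] by (simp add: B_def g_kernel_1)
  next
    case (Suc n)
    have "frac_int \<gamma> u s \<le> frac_int \<gamma> (B n) s"
    proof (rule frac_int_mono)
      show "\<bar>B n r\<bar> \<le> B n s" if "r < s" for r
        using B_mono[of r s n] B_nonneg[of n r] that by auto
      show "\<bar>u r\<bar> \<le> K" if "0 < r" "r < s" for r
        using uK that Suc.prems by auto
    qed (use Suc \<gamma> in auto)
    then have "u s \<le> a + b * g_kernel (\<gamma> + 1) s + L * frac_int \<gamma> (B n) s"
      using u[OF Suc.prems] L by (smt (verit) mult_left_mono)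
    also have "\<dots> = B (Suc n) s"
      unfolding fB B_def sum.lessThan_Suc_shift using Suc.prems
      by (simp add: g_kernel_1 sum_distrib_left distrib_left mult_ac)
    finally show ?case .
  qed
  \<comment> \<open>The \<open>b\<close> terms carry one more power of
    \<open>t powr \<gamma>\<close> than the Mittag-Leffler terms with the same \<open>L ^ k\<close>;
    superadditivity of Gamma splits it off. This is weaker than the exact series but has the shape
    that occurs in \<open>existence_time\<close>.\<close>
  have gs: "L ^ k * g_kernel (real (Suc k) * \<gamma> + 1) t \<le> g_kernel (\<gamma> + 1) t * m k" for k
  proof -
    have G: "0 < Gamma (real k * \<gamma> + 1)" "0 < Gamma (\<gamma> + 1)"
      using \<gamma> by (auto intro!: Gamma_real_pos add_nonneg_pos)
    have le: "Gamma (\<gamma> + 1) * Gamma (real k * \<gamma> + 1) \<le> Gamma (\<gamma> + real k * \<gamma> + 1)"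
      using Gamma_superadditive[of \<gamma> "real k * \<gamma>"] \<gamma> by simp
    have "L ^ k * g_kernel (real (Suc k) * \<gamma> + 1) t = L ^ k * (t powr \<gamma> * t powr (real k * \<gamma>)) / Gamma (\<gamma> + real k * \<gamma> + 1)"
      using t by (simp add: g_kernel_def powr_add[symmetric] algebra_simps)
    also have "\<dots> \<le> L ^ k * (t powr \<gamma> * t powr (real k * \<gamma>)) / (Gamma (\<gamma> + 1) * Gamma (real k * \<gamma> + 1))"
      using le \<gamma> L G less_le_trans[OF mult_pos_pos[OF G(2,1)] le]
      by (intro divide_left_mono mult_nonneg_nonneg mult_pos_pos) auto
    also have "\<dots> = g_kernel (\<gamma> + 1) t * m k"
      using t unfolding m_def g_kernel_powr_power[OF t(1), symmetric] by (simp add: g_kernel_def)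
    finally show ?thesis .
  qed
  have "u t \<le> (a + b * g_kernel (\<gamma> + 1) t) * mittag_leffler \<gamma> (L * t powr \<gamma>) + K * m n" for n
  proof -
    have "u t \<le> B n t" by (rule main[OF t])
    also have "\<dots> = (\<Sum>k<n. a * m k + b * (L ^ k * g_kernel (real (Suc k) * \<gamma> + 1) t)) + K * m n"
      unfolding B_def m_def g_kernel_powr_power[OF t(1), symmetric] by (simp add: algebra_simps)
    also have "\<dots> \<le> (\<Sum>k<n. a * m k + b * (g_kernel (\<gamma> + 1) t * m k)) + K * m n"
      using b gs by (intro add_mono sum_mono mult_left_mono order_refl) auto
    also have "(\<Sum>k<n. a * m k + b * (g_kernel (\<gamma> + 1) t * m k)) = (a + b * g_kernel (\<gamma> + 1) t) * (\<Sum>k<n. m k)"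
      by (simp add: sum.distrib sum_distrib_left distrib_right) (simp add: mult_ac)
    also have "\<dots> \<le> (a + b * g_kernel (\<gamma> + 1) t) * mittag_leffler \<gamma> (L * t powr \<gamma>)"
      unfolding m_def using assms
      by (intro mult_left_mono sum_le_mittag_leffler add_nonneg_nonneg mult_nonneg_nonneg g_kernel_nonneg) auto
    finally show ?thesis by simp
  qed
  moreover have "(\<lambda>n. (a + b * g_kernel (\<gamma> + 1) t) * mittag_leffler \<gamma> (L * t powr \<gamma>) + K * m n)
     \<longlonglongrightarrow> (a + b * g_kernel (\<gamma> + 1) t) * mittag_leffler \<gamma> (L * t powr \<gamma>) + K * 0"
    unfolding m_def by (intro tendsto_intros summable_LIMSEQ_zero summable_mittag_leffler \<gamma>)
  ultimately show ?thesis by (intro LIMSEQ_le_const[of _ _ "u t"]) auto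
qed

section \<open>The Volterra equation\<close>

lemma volterra_solution_exists:
  fixes F :: "real \<Rightarrow> real \<Rightarrow> real"
  assumes \<gamma>: "0 < \<gamma>" "\<gamma> \<le> 1" and T: "0 < T" and L: "0 \<le> L"
    and cont: "continuous_on UNIV (\<lambda>(t, x). F t x)"
    and B: "\<And>t x. \<bar>F t x\<bar> \<le> B" and lip: "\<And>t x y. \<bar>F t x - F t y\<bar> \<le> L * \<bar>x - y\<bar>"
  obtains v where "continuous_on UNIV v" "\<And>t. 0 \<le> t \<Longrightarrow> t \<le> T \<Longrightarrow> v t = c + frac_int \<gamma> (\<lambda>s. F s (v s)) t"
proof -
  \<comment> \<open>Freezing time outside [0,T] keeps the image bounded and continuous on the whole
    line, as the complete space of bounded continuous functions demands.\<close>
  define \<tau> where "\<tau> t = max 0 (min T t)" for t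
  have \<tau>: "0 \<le> \<tau> t" "\<tau> t \<le> T" "\<tau> (\<tau> t) = \<tau> t" for t using T by (auto simp: \<tau>_def)
  have F_cont: "continuous_on UNIV (\<lambda>s. F s (u s))" if "continuous_on UNIV u" for u
    using continuous_on_compose2[OF cont continuous_on_Pair[OF continuous_on_id that]] by simp
  have F_meas: "(\<lambda>s. F s (u s)) \<in> borel_measurable borel" if "continuous_on UNIV u" for u
    by (rule borel_measurable_continuous_onI[OF F_cont[OF that]])
  define \<Phi> where "\<Phi> u t = c + frac_int \<gamma> (\<lambda>s. F s (apply_bcontfun u s)) (\<tau> t)" for u :: "real \<Rightarrow>\<^sub>C real" and t
  have \<Phi>_bcontfun: "\<Phi> u \<in> bcontfun" for u
  proof (rule bcontfun_normI)
    have "continuous_on {..T} (frac_int \<gamma> (\<lambda>s. F s (apply_bcontfun u s)))"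
      by (rule frac_int_continuous_on[OF \<gamma> F_meas B]) simp
    moreover have "continuous_on UNIV \<tau>" unfolding \<tau>_def by (intro continuous_intros)
    ultimately have "continuous_on UNIV (\<lambda>t. frac_int \<gamma> (\<lambda>s. F s (apply_bcontfun u s)) (\<tau> t))"
      by (rule continuous_on_compose2) (use \<tau> in auto)
    then show "continuous_on UNIV (\<Phi> u)" unfolding \<Phi>_def[abs_def] by (intro continuous_intros)
    fix t
    have "\<bar>frac_int \<gamma> (\<lambda>s. F s (apply_bcontfun u s)) (\<tau> t)\<bar> \<le> frac_int \<gamma> (\<lambda>_. B) (\<tau> t)"
      by (rule abs_frac_int_le[where K = B]) (use \<gamma> B F_meas in auto)
    also have "\<dots> \<le> B * g_kernel (\<gamma> + 1) T"
      using g_kernel_mono[of "\<gamma> + 1" "\<tau> t" T] \<gamma> \<tau> order_trans[OF abs_ge_zero B]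
      by (auto simp: frac_int_const intro!: mult_left_mono)
    finally show "norm (\<Phi> u t) \<le> \<bar>c\<bar> + B * g_kernel (\<gamma> + 1) T" by (simp add: \<Phi>_def)
  qed
  define G where "G u = Bcontfun (\<Phi> u)" for u
  have G: "apply_bcontfun (G u) t = c + frac_int \<gamma> (\<lambda>s. F s (apply_bcontfun u s)) (\<tau> t)" for u t
    unfolding G_def by (simp add: Bcontfun_inverse[OF \<Phi>_bcontfun] \<Phi>_def)
  have step: "\<bar>apply_bcontfun ((G ^^ n) u) t - apply_bcontfun ((G ^^ n) w) t\<bar>
      \<le> dist u w * (L ^ n * g_kernel (real n * \<gamma> + 1) t)" if "0 < t" "t \<le> T" for u w n t
    using that
  proof (induction n arbitrary: t)
    case 0
    then show ?case using dist_bounded[of u t w] by (simp add: g_kernel_1 dist_real_def)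
  next
    case (Suc n)
    let ?u = "(G ^^ n) u" and ?w = "(G ^^ n) w"
    have "\<tau> t = t" using Suc.prems by (simp add: \<tau>_def)
    then have "\<bar>apply_bcontfun ((G ^^ Suc n) u) t - apply_bcontfun ((G ^^ Suc n) w) t\<bar>
      = \<bar>frac_int \<gamma> (\<lambda>s. F s (apply_bcontfun ?u s)) t - frac_int \<gamma> (\<lambda>s. F s (apply_bcontfun ?w s)) t\<bar>"
      by (simp add: G)
    also have "\<dots> = \<bar>frac_int \<gamma> (\<lambda>s. F s (apply_bcontfun ?u s) - F s (apply_bcontfun ?w s)) t\<bar>"
      by (subst frac_int_diff[where K = B and K' = B]) (use \<gamma> B F_meas in auto)
    also have "\<dots> \<le> frac_int \<gamma> (\<lambda>s. (L * dist u w * L ^ n) * g_kernel (real n * \<gamma> + 1) s) t"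
    proof (rule abs_frac_int_le)
      show "(\<lambda>s. F s (apply_bcontfun ?u s) - F s (apply_bcontfun ?w s)) \<in> borel_measurable borel"
        by (intro borel_measurable_diff F_meas) auto
      fix s assume s: "0 < s" "s < t"
      have "\<bar>F s (apply_bcontfun ?u s) - F s (apply_bcontfun ?w s)\<bar> \<le> L * \<bar>apply_bcontfun ?u s - apply_bcontfun ?w s\<bar>"
        by (rule lip)
      also have "\<dots> \<le> L * (dist u w * (L ^ n * g_kernel (real n * \<gamma> + 1) s))"
        using Suc.IH[of s] s Suc.prems L by (intro mult_left_mono) auto
      finally show "\<bar>F s (apply_bcontfun ?u s) - F s (apply_bcontfun ?w s)\<bar> \<le> (L * dist u w * L ^ n) * g_kernel (real n * \<gamma> + 1) s"
        by (simp add: mult_ac)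
      show "(L * dist u w * L ^ n) * g_kernel (real n * \<gamma> + 1) s \<le> (L * dist u w * L ^ n) * g_kernel (real n * \<gamma> + 1) t"
        using L s \<gamma> by (intro mult_left_mono g_kernel_mono) auto
    qed (use \<gamma> in auto)
    also have "\<dots> = (L * dist u w * L ^ n) * g_kernel (\<gamma> + (real n * \<gamma> + 1)) t"
      using \<gamma> by (simp only: frac_int_cmult) (simp add: frac_int_g_kernel add_nonneg_pos)
    also have "\<dots> = dist u w * (L ^ Suc n * g_kernel (real (Suc n) * \<gamma> + 1) t)"
      by (simp add: algebra_simps)
    finally show ?case .
  qed
  have "(\<lambda>n. L ^ n * g_kernel (real n * \<gamma> + 1) T) \<longlonglongrightarrow> 0"
    unfolding g_kernel_powr_power[OF T] by (intro summable_LIMSEQ_zero summable_mittag_leffler \<gamma>)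
  then have "\<forall>\<^sub>F n in sequentially. L ^ n * g_kernel (real n * \<gamma> + 1) T < 1 / 2"
    by (rule order_tendstoD) simp
  \<comment> \<open>\<open>1 \<le> n\<close> matters for \<open>t \<le> 0\<close>, which the kernel
    bound does not cover: after at least one application of \<open>G\<close> both functions equal
    \<open>c\<close> there.\<close>
  then obtain n where n: "1 \<le> n" "L ^ n * g_kernel (real n * \<gamma> + 1) T < 1 / 2"
    unfolding eventually_sequentially by (meson nat_le_linear order_trans)
  then obtain m where m: "n = Suc m" by (cases n) auto
  define q where "q = L ^ n * g_kernel (real n * \<gamma> + 1) T"
  have q: "0 \<le> q" "q < 1" using n L \<gamma> by (auto simp: q_def g_kernel_nonneg add_nonneg_pos)
  have "dist ((G ^^ n) u) ((G ^^ n) w) \<le> q * dist u w" for u w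
  proof (rule dist_bound)
    fix t
    show "dist (apply_bcontfun ((G ^^ n) u) t) (apply_bcontfun ((G ^^ n) w) t) \<le> q * dist u w"
    proof (cases "t \<le> 0")
      case True
      then have "\<tau> t = 0" using T by (simp add: \<tau>_def)
      then show ?thesis using q by (simp add: m G)
    next
      case False
      then have p: "0 < \<tau> t" using T by (simp add: \<tau>_def)
      have "dist (apply_bcontfun ((G ^^ n) u) t) (apply_bcontfun ((G ^^ n) w) t)
         = \<bar>apply_bcontfun ((G ^^ n) u) (\<tau> t) - apply_bcontfun ((G ^^ n) w) (\<tau> t)\<bar>"
        by (simp add: m G \<tau> dist_real_def)
      also have "\<dots> \<le> dist u w * (L ^ n * g_kernel (real n * \<gamma> + 1) (\<tau> t))"
        by (rule step[OF p \<tau>(2)])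
      also have "\<dots> \<le> dist u w * q"
        unfolding q_def using L \<gamma> \<tau> by (intro mult_left_mono g_kernel_mono) auto
      finally show ?thesis by (simp add: mult.commute)
    qed
  qed
  then have "\<exists>!x. (G ^^ n) x = x" by (intro banach_fix_type[OF q]) auto
  then obtain v where v: "(G ^^ n) v = v" "\<And>w. (G ^^ n) w = w \<Longrightarrow> w = v" by blast
  \<comment> \<open>\<open>G\<close> maps a fixed point of \<open>G ^^ n\<close> to another one, so
    by uniqueness the fixed point of the iterate is fixed by \<open>G\<close> itself.\<close>
  have "(G ^^ n) (G v) = G v" using v(1) by (metis funpow_swap1)
  then have Gv: "G v = v" by (rule v(2))
  show ?thesis
  proof (rule that[of "apply_bcontfun v"])
    fix t assume "0 \<le> t" "t \<le> T"
    then have "\<tau> t = t" by (simp add: \<tau>_def)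
    then show "apply_bcontfun v t = c + frac_int \<gamma> (\<lambda>s. F s (apply_bcontfun v s)) t"
      using G[of v t] by (simp add: Gv)
  qed simp
qed

section \<open>From the Volterra equation to the distributional equation\<close>

lemma continuous_on_UNIV_bounded_Icc:
  fixes h :: "real \<Rightarrow> real"
  assumes "continuous_on UNIV h"
  obtains K where "0 \<le> K" "\<And>s. a \<le> s \<Longrightarrow> s \<le> b \<Longrightarrow> \<bar>h s\<bar> \<le> K"
proof -
  have "bounded (h ` {a..b})"
    by (intro compact_imp_bounded compact_continuous_image continuous_on_subset[OF assms]) auto
  then obtain K where "0 < K" "\<forall>x\<in>h ` {a..b}. norm x \<le> K"
    unfolding bounded_pos by blast
  then show ?thesis by (intro that[of K]) auto
qed

lemma abs_frac_int_le_const: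
  assumes "0 < a" "h \<in> borel_measurable borel" "0 \<le> K"
    and "\<And>s. 0 < s \<Longrightarrow> s < t \<Longrightarrow> \<bar>h s\<bar> \<le> K" "r \<le> t"
  shows "\<bar>frac_int a h r\<bar> \<le> K * g_kernel (a + 1) t"
proof -
  have "\<bar>frac_int a h r\<bar> \<le> frac_int a (\<lambda>_. K) r"
    by (rule abs_frac_int_le[where K = K]) (use assms in auto)
  also have "\<dots> \<le> K * g_kernel (a + 1) t"
    using assms by (auto simp: frac_int_const intro!: mult_left_mono g_kernel_mono)
  finally show ?thesis .
qed

text \<open>\<open>J_primitive\<close> integrates a Lebesgue measurable function,
  \<open>frac_int\<close> a Borel one; the passage goes through a Borel representative
  \<open>w'\<close> that has to agree only almost everywhere on (0,t).\<close>

lemma J_primitive_eq_frac_int: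
  assumes "0 < t" and [measurable]: "w' \<in> borel_measurable borel"
    and [measurable]: "(\<lambda>s. indicator {0..<t} s * w s) \<in> borel_measurable lebesgue"
    and eq: "AE s in lebesgue. 0 < s \<and> s < t \<longrightarrow> w s = w' s"
    and "\<gamma> < 1"
  shows "J_primitive \<gamma> w t = frac_int (1 - \<gamma>) w' t"
proof -
  have G: "Gamma (1 - \<gamma>) \<noteq> 0" using less_imp_neq[OF Gamma_real_pos[of "1 - \<gamma>"]] assms by simp
  \<comment> \<open>The endpoint \<open>s = t\<close> may be dropped because
    \<open>0 powr x = 0\<close>.\<close>
  have e: "indicator {0..t} s *\<^sub>R ((t - s) powr - \<gamma> * w s) = (t - s) powr - \<gamma> * (indicator {0..<t} s * w s)" for s
    by (auto split: split_indicator)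
  then have "(LINT s:{0..t}|lebesgue. (t - s) powr - \<gamma> * w s)
     = (LINT s|lebesgue. (t - s) powr - \<gamma> * (indicator {0..<t} s * w s))"
    unfolding set_lebesgue_integral_def by (simp only: e)
  also have "\<dots> = (LINT s|lebesgue. Gamma (1 - \<gamma>) * (g_kernel (1 - \<gamma>) (t - s) * (indicator {0<..} s * w' s)))"
  proof (rule integral_cong_AE)
    have "AE s in lebesgue. s \<noteq> (0::real)" by (rule AE_completion[OF AE_lborel_singleton])
    then show "AE s in lebesgue. (t - s) powr - \<gamma> * (indicator {0..<t} s * w s)
        = Gamma (1 - \<gamma>) * (g_kernel (1 - \<gamma>) (t - s) * (indicator {0<..} s * w' s))"
      using eq
    proof eventually_elim
      case (elim s)
      then show ?case using assms(1) G by (cases "s < t") (auto simp: g_kernel_def split: split_indicator)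
    qed
    have "(\<lambda>s. Gamma (1 - \<gamma>) * (g_kernel (1 - \<gamma>) (t - s) * (indicator {0<..} s * w' s))) \<in> borel_measurable borel"
      by measurable
    then show "(\<lambda>s. Gamma (1 - \<gamma>) * (g_kernel (1 - \<gamma>) (t - s) * (indicator {0<..} s * w' s))) \<in> borel_measurable lebesgue"
      by (intro measurable_completion) simp
    have "(\<lambda>s. (t - s) powr - \<gamma>) \<in> borel_measurable borel"
      by measurable
    then have "(\<lambda>s. (t - s) powr - \<gamma>) \<in> borel_measurable lebesgue"
      by (intro measurable_completion) simp
    then show "(\<lambda>s. (t - s) powr - \<gamma> * (indicator {0..<t} s * w s)) \<in> borel_measurable lebesgue"
      by (intro borel_measurable_times assms)
  qed
  also have "\<dots> = (LINT s|lborel. Gamma (1 - \<gamma>) * (g_kernel (1 - \<gamma>) (t - s) * (indicator {0<..} s * w' s)))"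
    by (rule integral_completion) measurable
  also have "\<dots> = Gamma (1 - \<gamma>) * frac_int (1 - \<gamma>) w' t"
    by (simp add: frac_int_def)
  finally show ?thesis using assms(1) G by (simp add: J_primitive_def)
qed

lemma test_function_support:
  assumes "\<psi> \<in> test_functions S" "0 < S"
  obtains b where "0 < b" "b < S" "\<And>t. b \<le> t \<Longrightarrow> \<psi> t = 0" "\<And>t. b \<le> t \<Longrightarrow> deriv \<psi> t = 0"
proof -
  define C where "C = closure {t. \<psi> t \<noteq> 0}"
  have C: "compact C" "C \<subseteq> {..<S}" using assms by (auto simp: test_functions_def C_def)
  obtain b0 where b0: "b0 < S" "0 < b0" "\<And>t. t \<in> C \<Longrightarrow> t \<le> b0"
  proof (cases "C = {}")
    case True
    then show ?thesis using assms(2) by (intro that[of "S / 2"]) auto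
  next
    case False
    then obtain m where "m \<in> C" "\<And>t. t \<in> C \<Longrightarrow> t \<le> m"
      using compact_attains_sup[OF C(1)] by blast
    then show ?thesis using C assms(2) by (intro that[of "max m (S / 2)"]) (auto simp: le_max_iff_disj)
  qed
  have z: "\<psi> t = 0" if "b0 < t" for t
    using b0(3)[of t] that closure_subset[of "{t. \<psi> t \<noteq> 0}"] by (auto simp: C_def)
  \<comment> \<open>As \<open>b\<close> lies strictly above \<open>b0\<close>, \<open>\<psi>\<close>
    vanishes near every \<open>t \<ge> b\<close>, so its derivative vanishes at \<open>b\<close>
    too.\<close>
  define b where "b = (b0 + S) / 2"
  show ?thesis
  proof (rule that[of b])
    fix t assume t: "b \<le> t"
    then have "b0 < t" using b0 by (simp add: b_def)
    then have "\<forall>\<^sub>F x in nhds t. \<psi> x = 0"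
      using z by (intro eventually_nhds_in_open[of "{b0<..}" t, THEN eventually_mono]) auto
    then have "deriv \<psi> t = deriv (\<lambda>_. 0) t" by (rule deriv_cong_ev) simp
    then show "deriv \<psi> t = 0" by simp
  qed (use b0 z in \<open>auto simp: b_def\<close>)
qed

lemma g_kernel_has_derivative:
  assumes "0 < a" "0 < t"
  shows "(g_kernel (a + 1) has_real_derivative g_kernel a t) (at t)"
proof -
  have "((\<lambda>t. t powr a / Gamma (a + 1)) has_real_derivative (a * t powr (a - 1)) / Gamma (a + 1)) (at t)"
    using less_imp_neq[OF Gamma_real_pos[of "a + 1"]] assms by (auto intro!: derivative_eq_intros)
  moreover have "(a * t powr (a - 1)) / Gamma (a + 1) = g_kernel a t"
  proof -
    have "Gamma (a + 1) = a * Gamma a"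
      using assms by (intro Gamma_plus1) (auto elim!: nonpos_Ints_cases)
    then show ?thesis using assms by (simp add: g_kernel_def)
  qed
  ultimately have "((\<lambda>t. t powr a / Gamma (a + 1)) has_real_derivative g_kernel a t) (at t)" by simp
  then show ?thesis
    by (rule has_field_derivative_transform_within_open[where S = "{0<..}"]) (use assms in \<open>auto simp: g_kernel_def\<close>)
qed

text \<open>\<open>g_kernel a\<close> is the integral of order \<open>a - 1\<close> of the constant
  1, so continuity, also at 0, is inherited from fractional integrals.\<close>

lemma continuous_on_g_kernel:
  assumes "1 < a" "a \<le> 2"
  shows "continuous_on {..T} (g_kernel a)"
proof -
  have "continuous_on {..T} (frac_int (a - 1) (\<lambda>_. 1))"
    by (rule frac_int_continuous_on[where K = 1]) (use assms in auto)
  moreover have "frac_int (a - 1) (\<lambda>_. 1) = g_kernel a" using assms by (auto simp: frac_int_const)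
  ultimately show ?thesis by simp
qed

lemma g_kernel_absolutely_integrable:
  assumes "0 < a"
  shows "g_kernel a absolutely_integrable_on {0..b}"
proof -
  \<comment> \<open>\<open>b + 1\<close> instead of \<open>b\<close>: then
    \<open>g_kernel 1 (b + 1 - s)\<close> equals 1 on all of [0,b], including
    \<open>s = b\<close>.\<close>
  have "integrable lborel (\<lambda>s. g_kernel 1 (b + 1 - s) * g_kernel a (s - 0))"
    using has_bochner_integral_g_kernel_conv[OF zero_less_one assms] unfolding has_bochner_integral_iff by blast
  then have "integrable lborel (\<lambda>s. indicator {0..b} s *\<^sub>R (g_kernel 1 (b + 1 - s) * g_kernel a (s - 0)))"
    by (rule integrable_mult_indicator[rotated]) simp
  moreover have "indicator {0..b} s *\<^sub>R (g_kernel 1 (b + 1 - s) * g_kernel a (s - 0)) = indicator {0..b} s *\<^sub>R g_kernel a s" for s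
    by (auto simp: g_kernel_1 split: split_indicator)
  ultimately have "integrable lborel (\<lambda>s. indicator {0..b} s *\<^sub>R g_kernel a s)" by (simp only:)
  then show ?thesis unfolding set_integrable_def by (subst integrable_completion) auto
qed

text \<open>The primitive is explicit: I_(1-\<gamma>) maps \<open>c + frac_int \<gamma> h\<close> to
  \<open>P\<close>, whose derivative on the positive axis is
  \<open>c * g_kernel (1 - \<gamma>) + h\<close>. Its first part is the term that
  \<open>caputo\<close> subtracts.\<close>

lemma caputo_eq_of_volterra:
  assumes \<gamma>: "0 < \<gamma>" "\<gamma> < 1" and S: "0 < S"
    and v: "continuous_on UNIV v" and h: "continuous_on UNIV h"
    and eq: "\<And>t. 0 < t \<Longrightarrow> t < S \<Longrightarrow> v t = c + frac_int \<gamma> h t"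
  shows "dist_eq S (caputo \<gamma> c v) (regular_dist (zero_ext h))"
  unfolding dist_eq_def
proof
  fix \<psi> assume \<psi>: "\<psi> \<in> test_functions S"
  obtain b where b: "0 < b" "b < S" "\<And>t. b \<le> t \<Longrightarrow> \<psi> t = 0" "\<And>t. b \<le> t \<Longrightarrow> deriv \<psi> t = 0"
    using test_function_support[OF \<psi> S] by metis
  have hm[measurable]: "h \<in> borel_measurable borel" and vm[measurable]: "v \<in> borel_measurable borel"
    using v h by (auto intro: borel_measurable_continuous_onI)
  obtain K where K: "0 \<le> K" "\<And>s. 0 \<le> s \<Longrightarrow> s \<le> S \<Longrightarrow> \<bar>h s\<bar> \<le> K"
    using continuous_on_UNIV_bounded_Icc[OF h] by metis
  have df: "(deriv ^^ k) \<psi> differentiable_on UNIV" for k using \<psi> by (simp add: test_functions_def)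
  have d\<psi>: "(\<psi> has_real_derivative deriv \<psi> t) (at t)" for t
    using df[of 0] by (simp add: differentiable_on_def DERIV_deriv_iff_real_differentiable)
  have \<psi>_cont: "continuous_on A \<psi>" "continuous_on A (deriv \<psi>)" for A
    using differentiable_imp_continuous_on[OF df[of 0]] differentiable_imp_continuous_on[OF df[of 1]]
    by (auto intro: continuous_on_subset)
  define P where "P t = c * g_kernel (1 - \<gamma> + 1) t + frac_int 1 h t" for t
  have P_cont: "continuous_on {0..b} P"
    unfolding P_def[abs_def]
    by (intro continuous_intros continuous_on_subset[OF continuous_on_g_kernel[of _ b]]
         continuous_on_subset[OF frac_int_continuous_on[where T = b and K = K]])
       (use \<gamma> K b in auto)
  have J: "J_primitive \<gamma> v t = P t" if "t < S" for t
  proof (cases "0 < t")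
    case False
    then show ?thesis by (simp add: J_primitive_def P_def)
  next
    case True
    have "J_primitive \<gamma> v t = frac_int (1 - \<gamma>) v t"
      by (rule J_primitive_eq_frac_int) (use True \<gamma> in \<open>auto intro!: measurable_completion\<close>)
    also have "\<dots> = frac_int (1 - \<gamma>) (\<lambda>s. c + frac_int \<gamma> h s) t"
      by (rule frac_int_cong) (use eq that in \<open>auto intro!: AE_I2\<close>)
    also have "\<dots> = frac_int (1 - \<gamma>) (\<lambda>_. c) t + frac_int (1 - \<gamma>) (frac_int \<gamma> h) t"
      by (rule frac_int_add[where K' = "K * g_kernel (\<gamma> + 1) S"])
         (use \<gamma> K that in \<open>auto intro!: abs_frac_int_le_const\<close>)
    also have "frac_int (1 - \<gamma>) (frac_int \<gamma> h) t = frac_int (1 - \<gamma> + \<gamma>) h t"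
      by (rule frac_int_frac_int[where K = K]) (use \<gamma> K that in auto)
    finally show ?thesis using \<gamma> by (simp add: P_def frac_int_const)
  qed
  have "((\<lambda>t. (c * g_kernel (1 - \<gamma>) t + h t) * \<psi> t + P t * deriv \<psi> t) has_integral P b * \<psi> b - P 0 * \<psi> 0) {0..b}"
  \<comment> \<open>The integrand may blow up at 0 through \<open>g_kernel (1 - \<gamma>)\<close>;
    the interior form asks for derivatives on (0,b) and continuity of the product up to the ends.
    There \<open>P 0 = 0\<close> and \<open>\<psi> b = 0\<close> remove the boundary terms.\<close>
  proof (rule fundamental_theorem_of_calculus_interior)
    show "continuous_on {0..b} (\<lambda>t. P t * \<psi> t)" by (intro continuous_intros P_cont \<psi>_cont)
    fix t assume t: "t \<in> {0<..<b}"
    have "(P has_real_derivative c * g_kernel (1 - \<gamma>) t + h t) (at t)"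
      unfolding P_def[abs_def]
      by (intro DERIV_add DERIV_cmult g_kernel_has_derivative frac_int_1_has_derivative h) (use \<gamma> t in auto)
    then have "((\<lambda>t. P t * \<psi> t) has_real_derivative (c * g_kernel (1 - \<gamma>) t + h t) * \<psi> t + deriv \<psi> t * P t) (at t)"
      by (rule DERIV_mult[OF _ d\<psi>])
    then show "((\<lambda>t. P t * \<psi> t) has_vector_derivative (c * g_kernel (1 - \<gamma>) t + h t) * \<psi> t + P t * deriv \<psi> t) (at t)"
      by (simp add: has_real_derivative_iff_has_vector_derivative mult.commute)
  qed (use b in auto)
  then have FTC: "((\<lambda>t. c * (g_kernel (1 - \<gamma>) t * \<psi> t) + h t * \<psi> t + P t * deriv \<psi> t) has_integral 0) {0..b}"
    using b by (simp add: P_def algebra_simps)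
  have i1: "(\<lambda>t. P t * deriv \<psi> t) absolutely_integrable_on {0..b}"
    by (intro absolutely_integrable_continuous_real continuous_intros P_cont \<psi>_cont)
  have i2: "(\<lambda>t. h t * \<psi> t) absolutely_integrable_on {0..b}"
    by (intro absolutely_integrable_continuous_real continuous_intros \<psi>_cont continuous_on_subset[OF h]) auto
  have i3: "(\<lambda>t. g_kernel (1 - \<gamma>) t * \<psi> t) absolutely_integrable_on {0..b}"
  proof -
    have "(\<lambda>t. \<psi> t * g_kernel (1 - \<gamma>) t) absolutely_integrable_on {0..b}"
    proof (rule absolutely_integrable_bounded_measurable_product_real)
      show "\<psi> \<in> borel_measurable (lebesgue_on {0..b})"
        by (intro continuous_imp_measurable_on_sets_lebesgue \<psi>_cont) auto
      show "bounded (\<psi> ` {0..b})"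
        by (intro compact_imp_bounded compact_continuous_image \<psi>_cont) auto
      show "g_kernel (1 - \<gamma>) absolutely_integrable_on {0..b}"
        using \<gamma> by (intro g_kernel_absolutely_integrable) auto
    qed auto
    then show ?thesis by (simp add: mult.commute)
  qed
  have r: "regular_dist u \<phi> = integral {0..b} (\<lambda>t. w t * \<phi> t)"
    if "(\<lambda>t. w t * \<phi> t) absolutely_integrable_on {0..b}" "\<And>t. t \<le> b \<Longrightarrow> 0 \<le> t \<Longrightarrow> u t = w t" "\<And>t. t < 0 \<Longrightarrow> u t = 0" "\<And>t. b \<le> t \<Longrightarrow> \<phi> t = 0"
    for u w \<phi>
  proof -
    have e: "u t * \<phi> t = indicator {0..b} t *\<^sub>R (w t * \<phi> t)" for t
      using that(2)[of t] that(3)[of t] that(4)[of t] by (auto split: split_indicator)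
    then have "regular_dist u \<phi> = (LINT t:{0..b}|lebesgue. w t * \<phi> t)"
      unfolding regular_dist_def set_lebesgue_integral_def by (simp only: e)
    then show ?thesis using set_lebesgue_integral_eq_integral(2)[OF that(1)] by simp
  qed
  have "integral {0..b} (\<lambda>t. c * (g_kernel (1 - \<gamma>) t * \<psi> t) + h t * \<psi> t + P t * deriv \<psi> t)
     = c * integral {0..b} (\<lambda>t. g_kernel (1 - \<gamma>) t * \<psi> t) + integral {0..b} (\<lambda>t. h t * \<psi> t) + integral {0..b} (\<lambda>t. P t * deriv \<psi> t)"
    using i1 i2 i3
    by (intro integral_unique has_integral_add has_integral_mult_right integrable_integral)
       (auto simp: absolutely_integrable_on_def)
  then have "c * integral {0..b} (\<lambda>t. g_kernel (1 - \<gamma>) t * \<psi> t) + integral {0..b} (\<lambda>t. h t * \<psi> t) + integral {0..b} (\<lambda>t. P t * deriv \<psi> t) = 0"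
    using integral_unique[OF FTC] by simp
  moreover have "regular_dist (J_primitive \<gamma> v) (deriv \<psi>) = integral {0..b} (\<lambda>t. P t * deriv \<psi> t)"
    by (rule r[OF i1]) (use J b in \<open>auto simp: J_primitive_def\<close>)
  moreover have "regular_dist (g_kernel (1 - \<gamma>)) \<psi> = integral {0..b} (\<lambda>t. g_kernel (1 - \<gamma>) t * \<psi> t)"
    by (rule r[OF i3]) (use b in auto)
  moreover have "regular_dist (zero_ext h) \<psi> = integral {0..b} (\<lambda>t. h t * \<psi> t)"
    by (rule r[OF i2]) (use b in \<open>auto simp: zero_ext_def\<close>)
  ultimately show "caputo \<gamma> c v \<psi> = regular_dist (zero_ext h) \<psi>"
    by (simp add: caputo_def J_neg_def dist_deriv_def)
qed

text \<open>The average is the difference quotient at 0 of the primitive of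
  \<open>\<bar>v s - c\<bar>\<close>, so it tends to \<open>\<bar>v 0 - c\<bar>\<close>. The
  equivalence also settles uniqueness of the value that \<open>initial_value\<close> picks.\<close>

lemma has_initial_value_iff:
  assumes "continuous_on UNIV v"
  shows "has_initial_value v c \<longleftrightarrow> v 0 = c"
proof -
  define k where "k s = \<bar>v s - c\<bar>" for s
  have k: "continuous_on A k" for A
    unfolding k_def[abs_def] by (intro continuous_intros continuous_on_subset[OF assms]) auto
  have "((\<lambda>t. integral {0..t} k) has_real_derivative k 0) (at 0 within {0..1})"
    by (rule integral_has_real_derivative) (use k in auto)
  then have "((\<lambda>t. integral {0..t} k / t) \<longlongrightarrow> k 0) (at_right 0)"
    by (simp add: has_field_derivative_iff at_within_Icc_at_right)
  moreover have "\<forall>\<^sub>F t in at_right 0. integral {0..t} k / t = 1 / t * (LINT s:{0..t}|lebesgue. \<bar>v s - c\<bar>)"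
    using set_lebesgue_integral_eq_integral(2)[OF absolutely_integrable_continuous_real[OF k]]
    by (intro always_eventually allI) (simp add: k_def)
  ultimately have lim: "((\<lambda>t. 1 / t * (LINT s:{0..t}|lebesgue. \<bar>v s - c\<bar>)) \<longlongrightarrow> \<bar>v 0 - c\<bar>) (at_right 0)"
    unfolding k_def by (rule Lim_transform_eventually)
  show ?thesis
    unfolding has_initial_value_def
    using lim tendsto_unique[OF trivial_limit_at_right_real lim, of 0] by auto
qed

section \<open>Test functions approximating a ramp\<close>

text \<open>The classical smooth function exp(-1/y), flat at 0, with a polynomial factor in 1/y that
  makes the family closed under differentiation.\<close>

definition flat_poly :: "real poly \<Rightarrow> real \<Rightarrow> real" where
  "flat_poly p y = (if 0 < y then poly p (1 / y) * exp (- (1 / y)) else 0)"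

lemma poly_times_exp_tendsto_0: "((\<lambda>z. poly p z * exp (- z)) \<longlongrightarrow> (0 :: real)) at_top"
proof -
  have "((\<lambda>z. \<Sum>i\<le>degree p. coeff p i * (z ^ i / exp z)) \<longlongrightarrow> (\<Sum>i\<le>degree p. coeff p i * 0)) at_top"
    by (intro tendsto_intros tendsto_power_div_exp_0)
  then show ?thesis
    by (simp add: poly_altdef exp_minus divide_inverse sum_distrib_right mult.assoc)
qed

lemma flat_poly_has_derivative:
  "(flat_poly p has_real_derivative flat_poly (monom 1 2 * (p - pderiv p)) y) (at y)"
proof -
  consider "y < 0" | "y = 0" | "0 < y" by linarith
  then show ?thesis
  proof cases
    case 1
    have "((\<lambda>_. 0) has_real_derivative 0) (at y)" by simp
    then have "(flat_poly p has_real_derivative 0) (at y)"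
      by (rule has_field_derivative_transform_within_open[where S = "{..<0}"]) (use 1 in \<open>auto simp: flat_poly_def\<close>)
    then show ?thesis using 1 by (simp add: flat_poly_def)
  next
    case 2
    \<comment> \<open>From the right of 0 the difference quotient has the same form, with
      \<open>p\<close> multiplied by the variable, so it tends to 0.\<close>
    have "((\<lambda>h. poly (pCons 0 p) (1 / h) * exp (- (1 / h))) \<longlongrightarrow> 0) (at_right 0)"
      using filterlim_compose[OF poly_times_exp_tendsto_0 filterlim_inverse_at_top_right, of "pCons 0 p"]
      by (simp add: inverse_eq_divide)
    then have r: "((\<lambda>h. flat_poly p h / h) \<longlongrightarrow> 0) (at_right 0)"
      by (rule Lim_transform_eventually) (auto simp: eventually_at_filter flat_poly_def)
    have l: "((\<lambda>h. flat_poly p h / h) \<longlongrightarrow> 0) (at_left 0)"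
      by (rule Lim_transform_eventually[OF tendsto_const]) (auto simp: eventually_at_filter flat_poly_def)
    have "((\<lambda>h. flat_poly p h / h) \<longlongrightarrow> 0) (at 0)"
      by (rule filterlim_split_at_real[OF l r])
    then show ?thesis using 2 by (simp add: has_field_derivative_iff flat_poly_def)
  next
    case 3
    have "((\<lambda>y. poly p (1 / y) * exp (- (1 / y))) has_real_derivative
       poly (monom 1 2 * (p - pderiv p)) (1 / y) * exp (- (1 / y))) (at y)"
      using 3 by (auto intro!: derivative_eq_intros poly_DERIV[THEN DERIV_chain2]
          simp: poly_monom power2_eq_square field_simps)
    then have "(flat_poly p has_real_derivative poly (monom 1 2 * (p - pderiv p)) (1 / y) * exp (- (1 / y))) (at y)"
      by (rule has_field_derivative_transform_within_open[where S = "{0<..}"]) (use 3 in \<open>auto simp: flat_poly_def\<close>)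
    then show ?thesis using 3 by (simp add: flat_poly_def)
  qed
qed

text \<open>Closed under derivatives, so membership yields smoothness of all orders without a
  formula for the k-th derivative of a product. The affine arguments admit the rescaled and
  reflected factors of \<open>ramp_approx\<close>.\<close>

inductive_set flat_algebra :: "(real \<Rightarrow> real) set" where
  const: "(\<lambda>_. c) \<in> flat_algebra"
| ident: "(\<lambda>t. t) \<in> flat_algebra"
| flat: "(\<lambda>t. flat_poly p (x * t + y)) \<in> flat_algebra"
| add: "f \<in> flat_algebra \<Longrightarrow> g \<in> flat_algebra \<Longrightarrow> (\<lambda>t. f t + g t) \<in> flat_algebra"
| mult: "f \<in> flat_algebra \<Longrightarrow> g \<in> flat_algebra \<Longrightarrow> (\<lambda>t. f t * g t) \<in> flat_algebra"

lemma flat_algebra_derivative: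
  assumes "f \<in> flat_algebra"
  shows "\<exists>f'\<in>flat_algebra. \<forall>t. (f has_real_derivative f' t) (at t)"
  using assms
proof induction
  case (const c)
  show ?case by (rule bexI[of _ "\<lambda>_. 0"]) (auto intro: flat_algebra.intros)
next
  case ident
  show ?case by (rule bexI[of _ "\<lambda>_. 1"]) (auto intro: flat_algebra.intros)
next
  case (flat p x y)
  have "((\<lambda>t. flat_poly p (x * t + y)) has_real_derivative flat_poly (monom 1 2 * (p - pderiv p)) (x * t + y) * x) (at t)" for t
    by (rule DERIV_chain2[OF flat_poly_has_derivative]) (auto intro!: derivative_eq_intros)
  then show ?case
    by (intro bexI[of _ "\<lambda>t. flat_poly (monom 1 2 * (p - pderiv p)) (x * t + y) * x"])
       (auto intro: flat_algebra.intros)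
next
  case (add f g)
  then obtain f' g' where *: "f' \<in> flat_algebra" "g' \<in> flat_algebra"
    "\<And>t. (f has_real_derivative f' t) (at t)" "\<And>t. (g has_real_derivative g' t) (at t)" by blast
  then show ?case
    by (intro bexI[of _ "\<lambda>t. f' t + g' t"]) (auto intro: flat_algebra.intros DERIV_add)
next
  case (mult f g)
  then obtain f' g' where *: "f' \<in> flat_algebra" "g' \<in> flat_algebra"
    "\<And>t. (f has_real_derivative f' t) (at t)" "\<And>t. (g has_real_derivative g' t) (at t)" by blast
  then show ?case using mult.hyps
    by (intro bexI[of _ "\<lambda>t. f' t * g t + g' t * f t"]) (auto intro: flat_algebra.intros DERIV_mult)
qed

lemma flat_algebra_smooth:
  assumes "f \<in> flat_algebra"
  shows "(deriv ^^ k) f \<in> flat_algebra" "(deriv ^^ k) f differentiable_on UNIV"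
proof -
  show mem: "(deriv ^^ k) f \<in> flat_algebra" for k
  proof (induction k)
    case (Suc k)
    obtain f' where f': "f' \<in> flat_algebra" "\<And>t. ((deriv ^^ k) f has_real_derivative f' t) (at t)"
      using flat_algebra_derivative[OF Suc] by blast
    then have "deriv ((deriv ^^ k) f) = f'" by (auto intro: DERIV_imp_deriv)
    then show ?case using f' by simp
  qed (use assms in simp)
  show "(deriv ^^ k) f differentiable_on UNIV"
    using flat_algebra_derivative[OF mem[of k]]
    by (auto simp: differentiable_on_def real_differentiable_def)
qed

text \<open>The factor \<open>flat_poly 1 (n * (t + 1))\<close> only makes the support compact; it tends to \<open>1\<close> on \<open>t \<ge> 0\<close>,
  where the distributions live.\<close>

definition ramp_approx :: "real \<Rightarrow> nat \<Rightarrow> real \<Rightarrow> real" where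
  "ramp_approx b n t = (b - t) * (flat_poly 1 (real (Suc n) * (b - t)) * flat_poly 1 (real (Suc n) * (t + 1)))"

lemma ramp_approx_test_function:
  assumes "b < S"
  shows "ramp_approx b n \<in> test_functions S"
proof -
  have "(\<lambda>t. (b + (-1) * t) * (flat_poly 1 (- real (Suc n) * t + real (Suc n) * b) * flat_poly 1 (real (Suc n) * t + real (Suc n)))) \<in> flat_algebra"
    by (intro flat_algebra.intros)
  moreover have "ramp_approx b n = (\<lambda>t. (b + (-1) * t) * (flat_poly 1 (- real (Suc n) * t + real (Suc n) * b) * flat_poly 1 (real (Suc n) * t + real (Suc n))))"
    by (simp add: ramp_approx_def[abs_def] algebra_simps)
  ultimately have "ramp_approx b n \<in> flat_algebra" by simp
  moreover have "{t. ramp_approx b n t \<noteq> 0} \<subseteq> {-1..b}"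
    by (auto simp: ramp_approx_def flat_poly_def zero_less_mult_iff split: if_splits)
  then have "closure {t. ramp_approx b n t \<noteq> 0} \<subseteq> {-1..b}" by (rule closure_minimal) simp
  ultimately show ?thesis
    using assms unfolding test_functions_def
    by (auto intro: flat_algebra_smooth simp: compact_eq_bounded_closed intro: bounded_subset[of "{-1..b}"])
qed

section \<open>Uniform bounds and limits of the ramp approximations\<close>

lemma flat_poly_1: "0 < y \<Longrightarrow> flat_poly 1 y = exp (- (1 / y))"
  by (simp add: flat_poly_def)

lemma ramp_approx_bounds:
  assumes "0 \<le> t"
  shows "\<bar>ramp_approx b n t\<bar> \<le> \<bar>b\<bar> * g_kernel 1 (b - t)"
proof (cases "t < b")
  case True
  have "flat_poly 1 y \<in> {0..1}" for y by (auto simp: flat_poly_def)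
  then have "\<bar>flat_poly 1 (real (Suc n) * (b - t)) * flat_poly 1 (real (Suc n) * (t + 1))\<bar> \<le> 1"
    by (auto simp: abs_mult intro!: mult_le_one)
  then have "\<bar>ramp_approx b n t\<bar> \<le> \<bar>b - t\<bar> * 1"
    unfolding ramp_approx_def abs_mult[of "b - t"] by (intro mult_left_mono) auto
  then show ?thesis using True assms by (simp add: g_kernel_1)
next
  case False
  then have "flat_poly 1 (real (Suc n) * (b - t)) = 0" by (simp add: flat_poly_def zero_less_mult_iff)
  then show ?thesis using False by (simp add: ramp_approx_def)
qed

lemma inverse_Suc_tendsto_0: "(\<lambda>n. 1 / (real (Suc n) * c)) \<longlonglongrightarrow> 0"
proof -
  have "(\<lambda>n. inverse (real (Suc n)) * (1 / c)) \<longlonglongrightarrow> 0 * (1 / c)"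
    by (intro tendsto_mult LIMSEQ_inverse_real_of_nat tendsto_const)
  then show ?thesis by (simp add: divide_inverse mult.commute)
qed

lemma ramp_approx_tendsto:
  assumes "0 \<le> t"
  shows "(\<lambda>n. ramp_approx b n t) \<longlonglongrightarrow> g_kernel 2 (b - t)"
proof (cases "t < b")
  case True
  have "(\<lambda>n. (b - t) * (exp (- (1 / (real (Suc n) * (b - t)))) * exp (- (1 / (real (Suc n) * (t + 1))))))
     \<longlonglongrightarrow> (b - t) * (exp (- 0) * exp (- 0))"
    by (intro tendsto_intros inverse_Suc_tendsto_0)
  then show ?thesis using True assms
    by (simp add: ramp_approx_def flat_poly_1 g_kernel_2)
next
  case False
  then show ?thesis using ramp_approx_bounds[OF assms, of b] by simp
qed

text \<open>Differentiating the cut-offs produces a factor \<open>Suc n\<close>, which the zero of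
  the ramp at \<open>b\<close> absorbs: with \<open>z1\<close> the reciprocal of
  \<open>Suc n * (b - t)\<close>, the dangerous term is at most \<open>z1 * exp (- z1)\<close> in
  absolute value, which is bounded by 1 and tends to 0 with \<open>z1\<close>. The other cut-off is
  harmless because \<open>t + 1 \<ge> 1\<close>.\<close>

lemma ramp_approx_deriv:
  assumes "0 \<le> t"
  shows "\<bar>deriv (ramp_approx b n) t\<bar> \<le> (2 + \<bar>b\<bar>) * g_kernel 1 (b - t)"
    and "(\<lambda>n. deriv (ramp_approx b n) t) \<longlonglongrightarrow> - g_kernel 1 (b - t)"
proof -
  let ?B = "flat_poly (monom 1 2)"
  have D: "(flat_poly 1 has_real_derivative ?B y) (at y)" for y
    using flat_poly_has_derivative[of 1 y] by simp
  have d: "deriv (ramp_approx b n) t = - (flat_poly 1 (real (Suc n) * (b - t)) * flat_poly 1 (real (Suc n) * (t + 1)))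
     + (b - t) * (- real (Suc n) * ?B (real (Suc n) * (b - t)) * flat_poly 1 (real (Suc n) * (t + 1))
        + real (Suc n) * ?B (real (Suc n) * (t + 1)) * flat_poly 1 (real (Suc n) * (b - t)))" for n
    unfolding ramp_approx_def[abs_def]
    by (rule DERIV_imp_deriv) (auto intro!: derivative_eq_intros D[THEN DERIV_chain2] simp: algebra_simps)
  have e: "deriv (ramp_approx b n) t = - (E1 * E2) + (- (z1 * E1 * E2) + (b - t) / (t + 1) * (z2 * E2) * E1)"
    if "t < b" "z1 = 1 / (real (Suc n) * (b - t))" "z2 = 1 / (real (Suc n) * (t + 1))" "E1 = exp (- z1)" "E2 = exp (- z2)"
    for n z1 z2 E1 E2
  proof -
    have p: "0 < real (Suc n) * (b - t)" "0 < real (Suc n) * (t + 1)" using that assms by (auto intro!: mult_pos_pos)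
    have s1: "?B (real (Suc n) * (b - t)) = z1\<^sup>2 * E1" and s2: "?B (real (Suc n) * (t + 1)) = z2\<^sup>2 * E2"
      unfolding flat_poly_def that using p by (simp_all add: poly_monom)
    have q1: "(b - t) * (real (Suc n) * z1\<^sup>2) = z1" and q2: "(t + 1) * (real (Suc n) * z2\<^sup>2) = z2"
      unfolding that using that(1) assms by (auto simp: power2_eq_square)
    have "real (Suc n) * z2\<^sup>2 = z2 / (t + 1)" using q2 assms by (simp add: field_simps)
    then have "real (Suc n) * (z2\<^sup>2 * E2) = z2 / (t + 1) * E2" by (metis mult.assoc)
    then have r2: "(b - t) * (real (Suc n) * (z2\<^sup>2 * E2) * E1) = (b - t) / (t + 1) * (z2 * E2) * E1" by simp
    have r1: "(b - t) * (- real (Suc n) * (z1\<^sup>2 * E1) * E2) = - (z1 * E1 * E2)"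
      using q1 by (metis (no_types, opaque_lifting) mult.assoc mult_minus_left mult_minus_right)
    have "flat_poly 1 (real (Suc n) * (b - t)) = E1" "flat_poly 1 (real (Suc n) * (t + 1)) = E2"
      using p that by (simp_all add: flat_poly_1)
    then show ?thesis unfolding d s1 s2 by (simp only: distrib_left r1 r2)
  qed
  have z: "deriv (ramp_approx b n) t = 0" if "b \<le> t" for n
  proof -
    have "flat_poly p (real (Suc n) * (b - t)) = 0" for p using that by (simp add: flat_poly_def zero_less_mult_iff)
    then show ?thesis unfolding d by simp
  qed
  show "\<bar>deriv (ramp_approx b n) t\<bar> \<le> (2 + \<bar>b\<bar>) * g_kernel 1 (b - t)"
  proof (cases "t < b")
    case True
    define z1 z2 where "z1 = 1 / (real (Suc n) * (b - t))" and "z2 = 1 / (real (Suc n) * (t + 1))"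
    have z0: "0 \<le> z1" "0 \<le> z2" using True assms by (auto simp: z1_def z2_def)
    have le1: "x * exp (- x) \<le> 1" for x :: real
    proof -
      have "x \<le> exp x" using exp_ge_add_one_self[of x] by linarith
      then show ?thesis by (simp add: exp_minus field_simps)
    qed
    \<comment> \<open>The three summands of the derivative contribute 1, 1 and
      \<open>\<bar>b\<bar>\<close>, whence the constant \<open>2 + \<bar>b\<bar>\<close>.\<close>
    have "\<bar>exp (- z1) * exp (- z2)\<bar> \<le> 1" using z0 by (auto simp: abs_mult intro!: mult_le_one)
    moreover have "\<bar>z1 * exp (- z1) * exp (- z2)\<bar> \<le> 1"
      using z0 le1[of z1] by (auto simp: abs_mult intro!: mult_le_one)
    moreover have "\<bar>(b - t) / (t + 1) * (z2 * exp (- z2)) * exp (- z1)\<bar> \<le> \<bar>b\<bar>"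
    proof -
      have "(b - t) / (t + 1) \<le> b" using True assms by (simp add: field_simps)
      moreover have "(z2 * exp (- z2)) * exp (- z1) \<le> 1" using z0 le1[of z2] by (auto intro!: mult_le_one)
      ultimately have "(b - t) / (t + 1) * ((z2 * exp (- z2)) * exp (- z1)) \<le> b * 1"
        using True assms z0 by (intro mult_mono) auto
      then show ?thesis using True assms z0 by (simp add: abs_mult)
    qed
    moreover have "g_kernel 1 (b - t) = 1" using True by (simp add: g_kernel_1)
    ultimately show ?thesis
      unfolding e[OF True z1_def z2_def refl refl] by (simp only: mult_1_right)
  next
    case False
    then show ?thesis using z by simp
  qed
  show "(\<lambda>n. deriv (ramp_approx b n) t) \<longlonglongrightarrow> - g_kernel 1 (b - t)"
  proof (cases "t < b")
    case True
    define z1 z2 where "z1 n = 1 / (real (Suc n) * (b - t))" and "z2 n = 1 / (real (Suc n) * (t + 1))" for n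
    have "z1 \<longlonglongrightarrow> 0" "z2 \<longlonglongrightarrow> 0" unfolding z1_def[abs_def] z2_def[abs_def] by (rule inverse_Suc_tendsto_0)+
    then have "(\<lambda>n. - (exp (- z1 n) * exp (- z2 n)) + (- (z1 n * exp (- z1 n) * exp (- z2 n)) + (b - t) / (t + 1) * (z2 n * exp (- z2 n)) * exp (- z1 n)))
      \<longlonglongrightarrow> - (exp (- 0) * exp (- 0)) + (- (0 * exp (- 0) * exp (- 0)) + (b - t) / (t + 1) * (0 * exp (- 0)) * exp (- 0))"
      by (intro tendsto_intros)
    then show ?thesis unfolding e[OF True z1_def z2_def refl refl] using True by (simp add: g_kernel_1)
  next
    case False
    then show ?thesis using z by simp
  qed
qed

section \<open>From the distributional equation to the Volterra equation\<close>

text \<open>The positive and the negative part of \<open>R\<close> are densities of two measures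
  that agree and are finite on upper half-lines, hence agree everywhere; densities are unique almost
  everywhere.\<close>

lemma AE_zero_of_upper_integrals:
  assumes int: "integrable lborel R" and z: "\<And>x :: real. (LINT s|lborel. indicator {x<..} s * R s) = (0 :: real)"
  shows "AE s in lborel. R s = 0"
proof -
  have [measurable]: "R \<in> borel_measurable borel" using int by auto
  have fin: "(\<integral>\<^sup>+s. ennreal (indicator {x<..} s * R s) \<partial>lborel) < \<infinity>" "(\<integral>\<^sup>+s. ennreal (- (indicator {x<..} s * R s)) \<partial>lborel) < \<infinity>"
    and eq: "(\<integral>\<^sup>+s. ennreal (indicator {x<..} s * R s) \<partial>lborel) = (\<integral>\<^sup>+s. ennreal (- (indicator {x<..} s * R s)) \<partial>lborel)" for x
  proof -
    have i: "integrable lborel (\<lambda>s. indicator {x<..} s * R s)"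
      using integrable_mult_indicator[OF _ int, of "{x<..}"] by simp
    show fin: "(\<integral>\<^sup>+s. ennreal (indicator {x<..} s * R s) \<partial>lborel) < \<infinity>" "(\<integral>\<^sup>+s. ennreal (- (indicator {x<..} s * R s)) \<partial>lborel) < \<infinity>"
      using i unfolding real_integrable_def by (auto simp: less_top)
    show "(\<integral>\<^sup>+s. ennreal (indicator {x<..} s * R s) \<partial>lborel) = (\<integral>\<^sup>+s. ennreal (- (indicator {x<..} s * R s)) \<partial>lborel)"
      using z[of x] real_lebesgue_integral_def[OF i] fin by (metis eq_iff_diff_eq_0 ennreal_enn2real infinity_ennreal_def)
  qed
  have ind: "ennreal (R s) * indicator {x<..} s = ennreal (indicator {x<..} s * R s)"
      "ennreal (- R s) * indicator {x<..} s = ennreal (- (indicator {x<..} s * R s))" for s x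
    by (auto split: split_indicator)
  \<comment> \<open>\<open>ennreal\<close> sends negative numbers to 0, so these densities are the
    positive and the negative part of \<open>R\<close>; they coincide only where \<open>R\<close> is
    0.\<close>
  have "density lborel (\<lambda>s. ennreal (R s)) = density lborel (\<lambda>s. ennreal (- R s))"
  proof (rule measure_eqI_lessThan)
    show "emeasure (density lborel (\<lambda>s. ennreal (R s))) {x<..} < \<infinity>" for x
      using fin(1)[of x] by (simp add: emeasure_density ind)
    show "emeasure (density lborel (\<lambda>s. ennreal (R s))) {x<..} = emeasure (density lborel (\<lambda>s. ennreal (- R s))) {x<..}" for x
      using eq[of x] by (simp add: emeasure_density ind)
  qed auto
  then have "AE s in lborel. ennreal (R s) = ennreal (- R s)"
    by (intro sigma_finite_measure.density_unique_iff[OF sigma_finite_lborel, THEN iffD1]) auto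
  then show ?thesis
  proof eventually_elim
    case (elim s)
    show ?case
    proof (rule ccontr)
      assume "R s \<noteq> 0"
      then consider "0 < R s" | "0 < - R s" by linarith
      then show False using elim by cases (auto simp: ennreal_neg)
    qed
  qed
qed

lemma AE_zero_of_frac_int_1:
  assumes [measurable]: "r \<in> borel_measurable borel"
    and K: "\<And>s. 0 < s \<Longrightarrow> s < S \<Longrightarrow> \<bar>r s\<bar> \<le> K"
    and z: "\<And>t. 0 < t \<Longrightarrow> t < S \<Longrightarrow> frac_int 1 r t = 0"
  shows "AE t in lborel. 0 < t \<and> t < S \<longrightarrow> r t = 0"
proof -
  have e: "g_kernel 1 (x - s) * (indicator {0<..} s * r s) = indicator {0<..<x} s * r s" for x s
    by (auto simp: g_kernel_1 split: split_indicator)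
  have i: "integrable lborel (\<lambda>s. indicator {0<..<x} s * r s)" if "x \<le> S" for x
    using frac_int_integrable[of 1 r x K] K that unfolding e by simp
  have z': "(LINT s|lborel. indicator {0<..<x} s * r s) = 0" if "x < S" for x
  proof (cases "0 < x")
    case True
    then show ?thesis using z[of x] that unfolding frac_int_def e by simp
  qed simp
  \<comment> \<open>An integral of \<open>r\<close> from \<open>x\<close> to \<open>T\<close> is a
    difference of two integrals starting at 0, and both vanish.\<close>
  have AE: "AE s in lborel. indicator {0<..<T} s * r s = 0" if T: "T < S" for T
  proof (rule AE_zero_of_upper_integrals)
    show "integrable lborel (\<lambda>s. indicator {0<..<T} s * r s)" using i T by simp
    fix x
    have "(LINT s|lborel. indicator {x<..} s * (indicator {0<..<T} s * r s))
       = (LINT s|lborel. indicator {0<..<T} s * r s - indicator {0<..<min x T} s * r s)"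
    proof (rule integral_cong_AE)
      show "AE s in lborel. indicator {x<..} s * (indicator {0<..<T} s * r s) = indicator {0<..<T} s * r s - indicator {0<..<min x T} s * r s"
        using AE_lborel_singleton[of x] by eventually_elim (auto split: split_indicator)
    qed measurable
    also have "\<dots> = 0" using i z' T by (subst Bochner_Integration.integral_diff) auto
    finally show "(LINT s|lborel. indicator {x<..} s * (indicator {0<..<T} s * r s)) = 0" .
  qed
  \<comment> \<open>The hypothesis covers times strictly below \<open>S\<close>, so (0,S) is
    exhausted by countably many \<open>T\<close>.\<close>
  have "AE s in lborel. \<forall>n. indicator {0<..<S - 1 / real (Suc n)} s * r s = 0"
    unfolding AE_all_countable using AE by simp
  then show ?thesis
  proof eventually_elim
    case (elim s)
    show ?case
    proof
      assume s: "0 < s \<and> s < S"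
      then obtain n where "1 / real (Suc n) < S - s" using nat_approx_posE[of "S - s"] by auto
      then show "r s = 0" using elim[rule_format, of n] s by auto
    qed
  qed
qed

text \<open>Since I_2 r = I_1 (I_1 r), one differentiation leaves I_1 r = 0 and the case of order
  one applies.\<close>

lemma AE_zero_of_frac_int_2:
  assumes [measurable]: "r \<in> borel_measurable borel"
    and K: "\<And>s. 0 < s \<Longrightarrow> s < S \<Longrightarrow> \<bar>r s\<bar> \<le> K"
    and z: "\<And>t. 0 < t \<Longrightarrow> t < S \<Longrightarrow> frac_int 2 r t = 0"
  shows "AE t in lborel. 0 < t \<and> t < S \<longrightarrow> r t = 0"
proof (rule AE_zero_of_frac_int_1[where K = K])
  fix t assume t: "0 < t" "t < S"
  \<comment> \<open>Freezing I_1 r after \<open>t\<close> gives a function continuous on the whole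
    line, as the derivative rule for \<open>frac_int 1\<close> demands; the value at
    \<open>t\<close> itself follows from left continuity.\<close>
  define k where "k s = frac_int 1 r (min s t)" for s
  have "continuous_on {..t} (frac_int 1 r)"
    by (rule frac_int_continuous_on[where K = K]) (use K t in auto)
  then have "continuous_on UNIV k"
    unfolding k_def[abs_def] by (rule continuous_on_compose2) (auto intro!: continuous_intros)
  then have d: "(frac_int 1 k has_real_derivative k s) (at s)" if "0 < s" for s
    using that by (rule frac_int_1_has_derivative)
  have km[measurable]: "k \<in> borel_measurable borel" unfolding k_def[abs_def] by measurable
  have zero: "frac_int 1 k s = 0" if "0 < s" "s < t" for s
  proof -
    have "frac_int 1 k s = frac_int 1 (frac_int 1 r) s"
      by (rule frac_int_cong) (use that in \<open>auto simp: k_def\<close>)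
    also have "\<dots> = frac_int (1 + 1) r s" by (rule frac_int_frac_int[where K = K]) (use K that t in auto)
    finally show ?thesis using z[of s] that t by simp
  qed
  have k0: "k s = 0" if s: "0 < s" "s < t" for s
  proof -
    have "((\<lambda>_. 0) has_real_derivative k s) (at s)"
      by (rule has_field_derivative_transform_within_open[OF d, where S = "{0<..<t}"]) (use s zero in auto)
    then show ?thesis using DERIV_unique DERIV_const by blast
  qed
  have "k \<midarrow>t\<rightarrow> k t" using \<open>continuous_on UNIV k\<close> by (simp add: continuous_on_def)
  then have "(k \<longlongrightarrow> k t) (at_left t)" by (rule tendsto_within_subset) simp
  moreover have "(k \<longlongrightarrow> 0) (at_left t)"
  proof (rule Lim_transform_eventually[OF tendsto_const])
    show "\<forall>\<^sub>F s in at_left t. 0 = k s"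
      using eventually_at_left_real[OF t(1)] by eventually_elim (use k0 in auto)
  qed
  ultimately have "k t = 0" by (intro tendsto_unique[OF trivial_limit_at_left_real]) auto
  then show "frac_int 1 r t = 0" by (simp add: k_def)
qed (use K in auto)

text \<open>As \<open>u\<close> vanishes before 0, the bound and the limit are asked for on
  \<open>0 \<le> t\<close> only, so the behaviour of the test functions at negative times is
  invisible.\<close>

lemma integral_tendsto_of_test_functions:
  assumes [measurable]: "u \<in> borel_measurable borel" "\<And>n. \<phi> n \<in> borel_measurable borel" "\<psi> \<in> borel_measurable borel"
    and int: "integrable lborel (\<lambda>t. g_kernel 1 (b - t) * u t)" and u0: "\<And>t. t < 0 \<Longrightarrow> u t = 0"
    and bound: "\<And>n t. 0 \<le> t \<Longrightarrow> \<bar>\<phi> n t\<bar> \<le> C * g_kernel 1 (b - t)"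
    and lim: "\<And>t. 0 \<le> t \<Longrightarrow> (\<lambda>n. \<phi> n t) \<longlonglongrightarrow> \<psi> t"
  shows "(\<lambda>n. LINT t|lborel. u t * \<phi> n t) \<longlonglongrightarrow> (LINT t|lborel. u t * \<psi> t)"
proof (rule integral_dominated_convergence)
  show "integrable lborel (\<lambda>t. C * \<bar>g_kernel 1 (b - t) * u t\<bar>)" using int by simp
  show "AE t in lborel. (\<lambda>n. u t * \<phi> n t) \<longlonglongrightarrow> u t * \<psi> t"
  proof (rule AE_I2)
    fix t show "(\<lambda>n. u t * \<phi> n t) \<longlonglongrightarrow> u t * \<psi> t"
      using lim[of t] u0[of t] by (cases "0 \<le> t") (auto intro!: tendsto_mult)
  qed
  show "AE t in lborel. norm (u t * \<phi> n t) \<le> C * \<bar>g_kernel 1 (b - t) * u t\<bar>" for n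
  proof (rule AE_I2)
    fix t show "norm (u t * \<phi> n t) \<le> C * \<bar>g_kernel 1 (b - t) * u t\<bar>"
    proof (cases "0 \<le> t")
      case True
      have "\<bar>u t\<bar> * \<bar>\<phi> n t\<bar> \<le> \<bar>u t\<bar> * (C * g_kernel 1 (b - t))"
        by (intro mult_left_mono bound True) simp
      then show ?thesis by (simp add: abs_mult g_kernel_1 mult_ac)
    qed (use u0 in simp)
  qed
qed measurable

text \<open>Passing to bounded Borel representatives \<open>w'\<close> and \<open>h'\<close> makes
  the semigroup law available. The conclusion can hold only almost everywhere, since the hypotheses
  do not see null sets.\<close>

lemma volterra_of_weak:
  assumes \<gamma>: "0 < \<gamma>" "\<gamma> < 1"
    and weak: "dist_eq S (caputo \<gamma> c w) (regular_dist (zero_ext h))"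
    and wL: "(\<lambda>t. indicator {0..<S} t * w t) \<in> borel_measurable lebesgue"
    and hL: "(\<lambda>t. indicator {0..<S} t * h t) \<in> borel_measurable lebesgue"
    and [measurable]: "w' \<in> borel_measurable borel" "h' \<in> borel_measurable borel"
    and K: "\<And>t. \<bar>w' t\<bar> \<le> K" "\<And>t. \<bar>h' t\<bar> \<le> K"
    and eq: "AE t in lebesgue. 0 < t \<and> t < S \<longrightarrow> w t = w' t \<and> h t = h' t"
  shows "AE t in lborel. 0 < t \<and> t < S \<longrightarrow> w' t = c + frac_int \<gamma> h' t"
proof -
  have K0: "0 \<le> K" using K(1)[of 0] by linarith
  have ind: "(\<lambda>t. indicator {0..<t'} t * u t) \<in> borel_measurable lebesgue"
    if "(\<lambda>t. indicator {0..<S} t * u t) \<in> borel_measurable lebesgue" "t' \<le> S" for u :: "real \<Rightarrow> real" and t'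
  proof -
    have "(\<lambda>t. indicator {0..<t'} t * (indicator {0..<S} t * u t)) \<in> borel_measurable lebesgue"
      by (rule borel_measurable_times[OF _ that(1)]) (intro borel_measurable_indicator sets_completionI_sets, simp)
    moreover have "indicator {0..<t'} t * (indicator {0..<S} t * u t) = indicator {0..<t'} t * u t" for t
      using that(2) by (auto split: split_indicator)
    ultimately show ?thesis by (simp only:)
  qed
  have J: "J_primitive \<gamma> w t = frac_int (1 - \<gamma>) w' t" if "t < S" for t
  proof (cases "0 < t")
    case True
    then show ?thesis
      by (intro J_primitive_eq_frac_int ind[OF wL]) (use eq that \<gamma> in \<open>auto elim: eventually_mono\<close>)
  qed (simp add: J_primitive_def)
  have key: "frac_int (2 - \<gamma>) w' b = c * g_kernel (3 - \<gamma>) b + frac_int 2 h' b" if b: "0 < b" "b < S" for b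
  proof -
    let ?\<psi> = "ramp_approx b" and ?d = "\<lambda>n. deriv (ramp_approx b n)"
    have tf: "?\<psi> n \<in> test_functions S" for n by (rule ramp_approx_test_function[OF b(2)])
    have df: "(deriv ^^ k) (?\<psi> n) differentiable_on UNIV" for k n using tf[of n] by (simp add: test_functions_def)
    have m[measurable]: "?\<psi> n \<in> borel_measurable borel" "?d n \<in> borel_measurable borel" for n
      using differentiable_imp_continuous_on[OF df[of 0 n]] differentiable_imp_continuous_on[OF df[of 1 n]]
      by (auto intro: borel_measurable_continuous_onI)
    have z: "?\<psi> n t = 0" "?d n t = 0" if "b \<le> t" for n t
      using ramp_approx_bounds[of t b n] ramp_approx_deriv(1)[of t b n] that b by auto
    define hh where "hh t = indicator {0<..} t * h' t" for t
    have [measurable]: "hh \<in> borel_measurable borel" unfolding hh_def[abs_def] by measurable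
    have eqn: "- (LINT t|lborel. frac_int (1 - \<gamma>) w' t * ?d n t) - c * (LINT t|lborel. g_kernel (1 - \<gamma>) t * ?\<psi> n t)
       = (LINT t|lborel. hh t * ?\<psi> n t)" for n
    proof -
      have "regular_dist (J_primitive \<gamma> w) (?d n) = (LINT t|lebesgue. frac_int (1 - \<gamma>) w' t * ?d n t)"
        unfolding regular_dist_def
      proof (rule Bochner_Integration.integral_cong)
        fix t
        show "J_primitive \<gamma> w t * ?d n t = frac_int (1 - \<gamma>) w' t * ?d n t"
          using J[of t] z[of t] b by (cases "t < S") auto
      qed simp
      also have "\<dots> = (LINT t|lborel. frac_int (1 - \<gamma>) w' t * ?d n t)"
        by (rule integral_completion) measurable
      finally have 1: "regular_dist (J_primitive \<gamma> w) (?d n) = (LINT t|lborel. frac_int (1 - \<gamma>) w' t * ?d n t)" .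
      have 2: "regular_dist (g_kernel (1 - \<gamma>)) (?\<psi> n) = (LINT t|lborel. g_kernel (1 - \<gamma>) t * ?\<psi> n t)"
        unfolding regular_dist_def by (rule integral_completion) measurable
      have "regular_dist (zero_ext h) (?\<psi> n) = (LINT t|lebesgue. (indicator {0..<S} t * h t) * ?\<psi> n t)"
        unfolding regular_dist_def
      proof (rule Bochner_Integration.integral_cong)
        fix t
        show "zero_ext h t * ?\<psi> n t = (indicator {0..<S} t * h t) * ?\<psi> n t"
          using z[of t n] b by (auto simp: zero_ext_def split: split_indicator)
      qed simp
      also have "\<dots> = (LINT t|lebesgue. hh t * ?\<psi> n t)"
      proof (rule integral_cong_AE)
        have "AE s in lebesgue. s \<noteq> (0::real)" by (rule AE_completion[OF AE_lborel_singleton])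
        then show "AE t in lebesgue. (indicator {0..<S} t * h t) * ?\<psi> n t = hh t * ?\<psi> n t"
          using eq
        proof eventually_elim
          case (elim t)
          then show ?case using z[of t n] b by (auto simp: hh_def split: split_indicator)
        qed
        have L: "?\<psi> n \<in> borel_measurable lebesgue" "hh \<in> borel_measurable lebesgue"
          by (intro measurable_completion; simp)+
        show "(\<lambda>t. (indicator {0..<S} t * h t) * ?\<psi> n t) \<in> borel_measurable lebesgue"
          by (intro borel_measurable_times[of "\<lambda>t. indicator {0..<S} t * h t"] hL L)
        show "(\<lambda>t. hh t * ?\<psi> n t) \<in> borel_measurable lebesgue"
          by (intro borel_measurable_times L)
      qed
      also have "\<dots> = (LINT t|lborel. hh t * ?\<psi> n t)"
        by (rule integral_completion) measurable
      finally have 3: "regular_dist (zero_ext h) (?\<psi> n) = (LINT t|lborel. hh t * ?\<psi> n t)" .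
      show ?thesis
        using bspec[OF weak[unfolded dist_eq_def] tf[of n]] by (simp add: caputo_def J_neg_def dist_deriv_def 1 2 3)
    qed
    have pos: "indicator {0<..} t * frac_int a u t = frac_int a u t" for a u t
      by (auto split: split_indicator)
    have Ib: "\<bar>frac_int (1 - \<gamma>) w' s\<bar> \<le> K * g_kernel (1 - \<gamma> + 1) b" if "s < b" for s
      by (rule abs_frac_int_le_const) (use \<gamma> K K0 that in auto)
    \<comment> \<open>The derivatives tend to \<open>- g_kernel 1 (b - t)\<close>, so this term
      becomes \<open>frac_int 1\<close> of \<open>frac_int (1 - \<gamma>) w'\<close>, of total order
      \<open>2 - \<gamma>\<close>. In \<open>l2\<close> and \<open>l3\<close> the ramp itself
      appears as the kernel of order 2.\<close>
    have l1: "(\<lambda>n. LINT t|lborel. frac_int (1 - \<gamma>) w' t * ?d n t) \<longlonglongrightarrow> (LINT t|lborel. frac_int (1 - \<gamma>) w' t * - g_kernel 1 (b - t))"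
    proof (rule integral_tendsto_of_test_functions[where C = "2 + \<bar>b\<bar>" and b = b])
      show "integrable lborel (\<lambda>t. g_kernel 1 (b - t) * frac_int (1 - \<gamma>) w' t)"
        using frac_int_integrable[of 1 "frac_int (1 - \<gamma>) w'" b "K * g_kernel (1 - \<gamma> + 1) b"] Ib
        by (simp add: pos)
    qed (use ramp_approx_deriv in auto)
    have l2: "(\<lambda>n. LINT t|lborel. g_kernel (1 - \<gamma>) t * ?\<psi> n t) \<longlonglongrightarrow> (LINT t|lborel. g_kernel (1 - \<gamma>) t * g_kernel 2 (b - t))"
    proof (rule integral_tendsto_of_test_functions[where C = "\<bar>b\<bar>" and b = b])
      show "integrable lborel (\<lambda>t. g_kernel 1 (b - t) * g_kernel (1 - \<gamma>) t)"
        using has_bochner_integral_g_kernel_conv[of 1 "1 - \<gamma>" b 0] \<gamma> by (auto simp: has_bochner_integral_iff)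
    qed (use ramp_approx_bounds ramp_approx_tendsto in auto)
    have l3: "(\<lambda>n. LINT t|lborel. hh t * ?\<psi> n t) \<longlonglongrightarrow> (LINT t|lborel. hh t * g_kernel 2 (b - t))"
    proof (rule integral_tendsto_of_test_functions[where C = "\<bar>b\<bar>" and b = b])
      show "integrable lborel (\<lambda>t. g_kernel 1 (b - t) * hh t)"
        unfolding hh_def by (rule frac_int_integrable[where K = K]) (use K in auto)
    qed (use ramp_approx_bounds ramp_approx_tendsto in \<open>auto simp: hh_def\<close>)
    have "(\<lambda>n. LINT t|lborel. hh t * ?\<psi> n t) \<longlonglongrightarrow>
       - (LINT t|lborel. frac_int (1 - \<gamma>) w' t * - g_kernel 1 (b - t)) - c * (LINT t|lborel. g_kernel (1 - \<gamma>) t * g_kernel 2 (b - t))"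
      unfolding eqn[symmetric] by (intro tendsto_intros l1 l2)
    from LIMSEQ_unique[OF l3 this]
    have "(LINT t|lborel. hh t * g_kernel 2 (b - t)) = (LINT t|lborel. frac_int (1 - \<gamma>) w' t * g_kernel 1 (b - t))
       - c * (LINT t|lborel. g_kernel (1 - \<gamma>) t * g_kernel 2 (b - t))" by simp
    moreover have "(LINT t|lborel. hh t * g_kernel 2 (b - t)) = frac_int 2 h' b"
      by (simp add: frac_int_def hh_def mult.commute)
    moreover have "(LINT t|lborel. frac_int (1 - \<gamma>) w' t * g_kernel 1 (b - t)) = frac_int 1 (frac_int (1 - \<gamma>) w') b"
      by (simp add: frac_int_def[of 1] pos mult.commute)
    moreover have "frac_int 1 (frac_int (1 - \<gamma>) w') b = frac_int (1 + (1 - \<gamma>)) w' b"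
      by (rule frac_int_frac_int) (use \<gamma> K in auto)
    moreover have "(LINT t|lborel. g_kernel (1 - \<gamma>) t * g_kernel 2 (b - t)) = g_kernel (2 + (1 - \<gamma>)) b"
      using has_bochner_integral_g_kernel_conv[of 2 "1 - \<gamma>" b 0] \<gamma> by (simp add: has_bochner_integral_iff mult.commute)
    ultimately show ?thesis by (simp add: algebra_simps)
  qed
  define r where "r s = w' s - (c + frac_int \<gamma> h' s)" for s
  have "AE t in lborel. 0 < t \<and> t < S \<longrightarrow> r t = 0"
  proof (rule AE_zero_of_frac_int_2)
    show "r \<in> borel_measurable borel" unfolding r_def[abs_def] by measurable
    have hb: "\<bar>frac_int \<gamma> h' s\<bar> \<le> K * g_kernel (\<gamma> + 1) S" if "s < S" for s
      by (rule abs_frac_int_le_const) (use \<gamma> K K0 that in auto)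
    show "\<bar>r s\<bar> \<le> K + (\<bar>c\<bar> + K * g_kernel (\<gamma> + 1) S)" if "0 < s" "s < S" for s
      using K(1)[of s] hb[of s] that unfolding r_def by linarith
    fix t assume t: "0 < t" "t < S"
    \<comment> \<open>On the left I_\<gamma> I_(2-\<gamma>) = I_2. On the right I_\<gamma> turns
      \<open>g_kernel (3 - \<gamma>)\<close> into \<open>g_kernel 3\<close>, which is I_2 of the
      constant 1, and I_\<gamma> I_2 = I_2 I_\<gamma>.\<close>
    have "frac_int 2 w' t = frac_int \<gamma> (frac_int (2 - \<gamma>) w') t"
      using frac_int_frac_int[of \<gamma> "2 - \<gamma>" w' t K] \<gamma> K by simp
    also have "\<dots> = frac_int \<gamma> (\<lambda>b. c * g_kernel (3 - \<gamma>) b + frac_int 2 h' b) t"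
      by (rule frac_int_cong) (use key t in auto)
    also have "\<dots> = frac_int \<gamma> (\<lambda>b. c * g_kernel (3 - \<gamma>) b) t + frac_int \<gamma> (frac_int 2 h') t"
    proof (rule frac_int_add)
      show "\<bar>c * g_kernel (3 - \<gamma>) s\<bar> \<le> \<bar>c\<bar> * g_kernel (3 - \<gamma>) t" if "s < t" for s
        using that \<gamma> by (auto simp: abs_mult g_kernel_nonneg intro!: mult_left_mono g_kernel_mono)
      show "\<bar>frac_int 2 h' s\<bar> \<le> K * g_kernel (2 + 1) t" if "s < t" for s
        by (rule abs_frac_int_le_const) (use K K0 that in auto)
    qed (use \<gamma> in auto)
    also have "\<dots> = c * g_kernel 3 t + frac_int (2 + \<gamma>) h' t"
      using frac_int_frac_int[of \<gamma> 2 h' t K] \<gamma> K by (simp add: frac_int_cmult frac_int_g_kernel add.commute)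
    also have "\<dots> = frac_int 2 (\<lambda>_. c) t + frac_int 2 (frac_int \<gamma> h') t"
      using frac_int_frac_int[of 2 \<gamma> h' t K] \<gamma> K by (simp add: frac_int_const)
    also have "\<dots> = frac_int 2 (\<lambda>s. c + frac_int \<gamma> h' s) t"
      by (rule frac_int_add[where K = "\<bar>c\<bar>" and K' = "K * g_kernel (\<gamma> + 1) S", symmetric]) (use hb t in auto)
    finally have e: "frac_int 2 w' t = frac_int 2 (\<lambda>s. c + frac_int \<gamma> h' s) t" .
    have "frac_int 2 r t = frac_int 2 w' t - frac_int 2 (\<lambda>s. c + frac_int \<gamma> h' s) t"
      unfolding r_def[abs_def]
    proof (rule frac_int_diff)
      show "\<bar>c + frac_int \<gamma> h' s\<bar> \<le> \<bar>c\<bar> + K * g_kernel (\<gamma> + 1) S" if "0 < s" "s < t" for s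
        using hb[of s] that t by linarith
    qed (use K in auto)
    then show "frac_int 2 r t = 0" using e by simp
  qed
  then show ?thesis by eventually_elim (auto simp: r_def)
qed

section \<open>Solutions of the initial value problem\<close>

lemma L1_loc_of_continuous:
  assumes "continuous_on UNIV k" and eq: "\<And>t. 0 \<le> t \<Longrightarrow> t < S \<Longrightarrow> u t = k t"
  shows "u \<in> L1_loc S"
  unfolding L1_loc_def
proof (intro CollectI allI impI)
  fix K :: "real set" assume K: "compact K \<and> K \<subseteq> {0..<S}"
  have "k absolutely_integrable_on {0..S}"
    by (intro absolutely_integrable_continuous_real continuous_on_subset[OF assms(1)]) auto
  moreover have "K \<in> sets lebesgue" using K by (auto intro!: sets_completionI_sets borel_compact)
  ultimately have "k absolutely_integrable_on K"
    by (rule set_integrable_subset) (use K in auto)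
  moreover have "indicator K t *\<^sub>R u t = indicator K t *\<^sub>R k t" for t
    using eq[of t] K by (auto split: split_indicator)
  ultimately show "u absolutely_integrable_on K" unfolding set_integrable_def by (simp only:)
qed

text \<open>\<open>L1_loc\<close> speaks about compact sets only, so the half-open interval is
  exhausted by closed ones.\<close>

lemma L1_loc_measurable:
  assumes "w \<in> L1_loc S"
  shows "(\<lambda>t. indicator {0..<S} t * w t) \<in> borel_measurable lebesgue"
proof (rule borel_measurable_LIMSEQ_real)
  fix n
  have lt: "S - 1 / real (Suc n) < S" by simp
  have "compact {0..S - 1 / real (Suc n)} \<and> {0..S - 1 / real (Suc n)} \<subseteq> {0..<S}"
    using le_less_trans[OF _ lt] by (intro conjI compact_Icc subsetI) (simp del: of_nat_Suc)
  then have "w absolutely_integrable_on {0..S - 1 / real (Suc n)}"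
    using assms unfolding L1_loc_def by blast
  then show "(\<lambda>t. indicator {0..S - 1 / real (Suc n)} t * w t) \<in> borel_measurable lebesgue"
    unfolding set_integrable_def by (auto dest: borel_measurable_integrable)
next
  fix t
  show "(\<lambda>n. indicator {0..S - 1 / real (Suc n)} t * w t) \<longlonglongrightarrow> indicator {0..<S} t * w t"
  proof (cases "t < S")
    case True
    have "(\<lambda>n. S - 1 / (real (Suc n) * 1)) \<longlonglongrightarrow> S - 0" by (intro tendsto_intros inverse_Suc_tendsto_0)
    then have "\<forall>\<^sub>F n in sequentially. t < S - 1 / (real (Suc n) * 1)"
      using True by (intro order_tendstoD) auto
    then have "\<forall>\<^sub>F n in sequentially. indicator {0..S - 1 / real (Suc n)} t * w t = indicator {0..<S} t * w t"
      by eventually_elim (use True in \<open>auto split: split_indicator\<close>)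
    then show ?thesis by (rule tendsto_eventually)
  next
    case False
    have "t \<notin> {0..S - 1 / real (Suc n)}" for n
    proof -
      have "S - 1 / real (Suc n) < t" using False by (intro less_le_trans[of _ S t]) auto
      then show ?thesis by (simp del: of_nat_Suc)
    qed
    then show ?thesis using False by simp
  qed
qed

lemma continuous_compose_measurable:
  fixes F :: "real \<Rightarrow> real \<Rightarrow> real"
  assumes "continuous_on UNIV (\<lambda>(t, x). F t x)" and u: "u \<in> borel_measurable borel"
  shows "(\<lambda>s. F s (u s)) \<in> borel_measurable borel"
proof -
  have "(\<lambda>s. (s, u s)) \<in> borel_measurable borel" using u by (intro borel_measurable_Pair) auto
  from measurable_compose[OF this borel_measurable_continuous_onI[OF assms(1)]] show ?thesis by simp
qed

text \<open>Gronwall with the constant source \<open>\<bar>a - b\<bar>\<close>. The case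
  \<open>a = b\<close> gives uniqueness, the general one continuity in the initial value.\<close>

lemma volterra_stability:
  fixes F :: "real \<Rightarrow> real \<Rightarrow> real"
  assumes \<gamma>: "0 < \<gamma>" and L: "0 \<le> L"
    and cont: "continuous_on UNIV (\<lambda>(t, x). F t x)"
    and B: "\<And>t x. \<bar>F t x\<bar> \<le> B" and lip: "\<And>t x y. \<bar>F t x - F t y\<bar> \<le> L * \<bar>x - y\<bar>"
    and m: "u \<in> borel_measurable borel" "v \<in> borel_measurable borel"
    and u: "\<And>t. 0 < t \<Longrightarrow> t < S \<Longrightarrow> u t = a + frac_int \<gamma> (\<lambda>s. F s (u s)) t"
    and v: "\<And>t. 0 < t \<Longrightarrow> t < S \<Longrightarrow> v t = b + frac_int \<gamma> (\<lambda>s. F s (v s)) t"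
    and t: "0 < t" "t < S"
  shows "\<bar>u t - v t\<bar> \<le> \<bar>a - b\<bar> * mittag_leffler \<gamma> (L * t powr \<gamma>)"
proof -
  have B0: "0 \<le> B" using order_trans[OF abs_ge_zero B] .
  note [measurable] = m continuous_compose_measurable[OF cont]
  have le: "\<bar>frac_int \<gamma> (\<lambda>s. F s (x s)) r\<bar> \<le> B * g_kernel (\<gamma> + 1) S"
    if "x \<in> borel_measurable borel" "r < S" for x r
    by (rule abs_frac_int_le_const) (use that \<gamma> B B0 continuous_compose_measurable[OF cont] in auto)
  have bound: "\<bar>u s - v s\<bar> \<le> \<bar>a - b\<bar> + 2 * (B * g_kernel (\<gamma> + 1) S)" if "0 < s" "s < S" for s
    using u[OF that] v[OF that] le[OF m(1) that(2)] le[OF m(2) that(2)] by linarith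
  have "\<bar>u t - v t\<bar> \<le> (\<bar>a - b\<bar> + 0 * g_kernel (\<gamma> + 1) t) * mittag_leffler \<gamma> (L * t powr \<gamma>)"
  proof (rule fractional_gronwall[where u = "\<lambda>s. \<bar>u s - v s\<bar>" and S = S])
    show "\<bar>\<bar>u s - v s\<bar>\<bar> \<le> \<bar>a - b\<bar> + 2 * (B * g_kernel (\<gamma> + 1) S)" if "0 < s" "s < S" for s
      using bound[OF that] by simp
    fix s assume s: "0 < s" "s < S"
    have "\<bar>u s - v s\<bar> \<le> \<bar>a - b\<bar> + \<bar>frac_int \<gamma> (\<lambda>s. F s (u s)) s - frac_int \<gamma> (\<lambda>s. F s (v s)) s\<bar>"
      using u[OF s] v[OF s] by linarith
    also have "frac_int \<gamma> (\<lambda>s. F s (u s)) s - frac_int \<gamma> (\<lambda>s. F s (v s)) s = frac_int \<gamma> (\<lambda>s. F s (u s) - F s (v s)) s"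
      by (rule frac_int_diff[symmetric]) (use \<gamma> B in auto)
    also have "\<bar>frac_int \<gamma> (\<lambda>s. F s (u s) - F s (v s)) s\<bar> \<le> frac_int \<gamma> (\<lambda>s. L * \<bar>u s - v s\<bar>) s"
    proof (rule abs_frac_int_le)
      show "L * \<bar>u r - v r\<bar> \<le> L * (\<bar>a - b\<bar> + 2 * (B * g_kernel (\<gamma> + 1) S))" if "0 < r" "r < s" for r
        using bound[of r] that s L by (intro mult_left_mono) auto
    qed (use \<gamma> lip in auto)
    finally show "\<bar>u s - v s\<bar> \<le> \<bar>a - b\<bar> + 0 * g_kernel (\<gamma> + 1) s + L * frac_int \<gamma> (\<lambda>s. \<bar>u s - v s\<bar>) s"
      by (simp add: frac_int_cmult)
  qed (use \<gamma> L t in auto)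
  then show ?thesis by simp
qed

text \<open>Comparison with the constant function \<open>c\<close>:
  \<open>\<bar>F s (v s)\<bar> \<le> M + L * \<bar>v s - c\<bar>\<close>, and I_\<gamma> of
  \<open>M\<close> is the source \<open>M * g_kernel (\<gamma> + 1)\<close> in Gronwall's
  inequality.\<close>

lemma volterra_growth:
  fixes F :: "real \<Rightarrow> real \<Rightarrow> real"
  assumes \<gamma>: "0 < \<gamma>" and L: "0 \<le> L"
    and cont: "continuous_on UNIV (\<lambda>(t, x). F t x)"
    and B: "\<And>t x. \<bar>F t x\<bar> \<le> B" and lip: "\<And>t x y. \<bar>F t x - F t y\<bar> \<le> L * \<bar>x - y\<bar>"
    and M: "\<And>t. \<bar>F t c\<bar> \<le> M"
    and m[measurable]: "v \<in> borel_measurable borel"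
    and v: "\<And>t. 0 < t \<Longrightarrow> t < S \<Longrightarrow> v t = c + frac_int \<gamma> (\<lambda>s. F s (v s)) t"
    and t: "0 < t" "t < S"
  shows "\<bar>v t - c\<bar> \<le> M * g_kernel (\<gamma> + 1) t * mittag_leffler \<gamma> (L * t powr \<gamma>)"
proof -
  have B0: "0 \<le> B" using order_trans[OF abs_ge_zero B] .
  have M0: "0 \<le> M" using order_trans[OF abs_ge_zero M] .
  note [measurable] = continuous_compose_measurable[OF cont]
  have bound: "\<bar>v s - c\<bar> \<le> B * g_kernel (\<gamma> + 1) S" if "0 < s" "s < S" for s
  proof -
    have "\<bar>frac_int \<gamma> (\<lambda>s. F s (v s)) s\<bar> \<le> B * g_kernel (\<gamma> + 1) S"
      by (rule abs_frac_int_le_const) (use that \<gamma> B B0 in auto)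
    then show ?thesis using v[OF that] by simp
  qed
  have "\<bar>v t - c\<bar> \<le> (0 + M * g_kernel (\<gamma> + 1) t) * mittag_leffler \<gamma> (L * t powr \<gamma>)"
  proof (rule fractional_gronwall[where u = "\<lambda>s. \<bar>v s - c\<bar>" and S = S])
    show "\<bar>\<bar>v s - c\<bar>\<bar> \<le> B * g_kernel (\<gamma> + 1) S" if "0 < s" "s < S" for s
      using bound[OF that] by simp
    fix s assume s: "0 < s" "s < S"
    have bound': "L * \<bar>v r - c\<bar> \<le> L * (B * g_kernel (\<gamma> + 1) S)" if "0 < r" "r < s" for r
      using bound[of r] that s L by (intro mult_left_mono) auto
    have "\<bar>v s - c\<bar> = \<bar>frac_int \<gamma> (\<lambda>s. F s (v s)) s\<bar>" using v[OF s] by simp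
    also have "\<dots> \<le> frac_int \<gamma> (\<lambda>s. M + L * \<bar>v s - c\<bar>) s"
    proof (rule abs_frac_int_le)
      show "M + L * \<bar>v r - c\<bar> \<le> M + L * (B * g_kernel (\<gamma> + 1) S)" if "0 < r" "r < s" for r
        using bound'[OF that] by simp
      show "\<bar>F r (v r)\<bar> \<le> M + L * \<bar>v r - c\<bar>" for r
        using lip[of r "v r" c] M[of r] by linarith
    qed (use \<gamma> in auto)
    also have "\<dots> = frac_int \<gamma> (\<lambda>_. M) s + frac_int \<gamma> (\<lambda>s. L * \<bar>v s - c\<bar>) s"
      by (rule frac_int_add[where K = M and K' = "L * (B * g_kernel (\<gamma> + 1) S)"])
         (use \<gamma> M0 L bound' in auto)
    finally show "\<bar>v s - c\<bar> \<le> 0 + M * g_kernel (\<gamma> + 1) s + L * frac_int \<gamma> (\<lambda>s. \<bar>v s - c\<bar>) s"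
      using \<gamma> by (simp add: frac_int_cmult frac_int_const)
  qed (use \<gamma> L M0 t in auto)
  then show ?thesis by simp
qed

text \<open>All estimates use the globally Lipschitz \<open>F\<close>; solutions for
  \<open>f\<close> do not notice, since their graphs lie in \<open>Dom\<close> for almost every
  time.\<close>

lemma unique_strong_solution_of_volterra:
  fixes f F :: "real \<Rightarrow> real \<Rightarrow> real"
  assumes \<gamma>: "0 < \<gamma>" "\<gamma> < 1" and L: "0 \<le> L" and S: "0 < S"
    and cont: "continuous_on UNIV (\<lambda>(t, x). F t x)"
    and B: "\<And>t x. \<bar>F t x\<bar> \<le> B" and lip: "\<And>t x y. \<bar>F t x - F t y\<bar> \<le> L * \<bar>x - y\<bar>"
    and Dom: "\<And>t x. (t, x) \<in> Dom \<Longrightarrow> F t x = f t x" "\<And>t x. (t, x) \<in> Dom \<Longrightarrow> \<bar>x\<bar> \<le> R"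
    and v_cont: "continuous_on UNIV v"
    and v: "\<And>t. 0 \<le> t \<Longrightarrow> t < S \<Longrightarrow> v t = c + frac_int \<gamma> (\<lambda>s. F s (v s)) t"
    and v_Dom: "\<And>t. 0 \<le> t \<Longrightarrow> t < S \<Longrightarrow> (t, v t) \<in> Dom"
  shows "unique_strong_solution \<gamma> f Dom c S v"
proof -
  have Fv_cont: "continuous_on UNIV (\<lambda>s. F s (v s))"
    using continuous_on_compose2[OF cont continuous_on_Pair[OF continuous_on_id v_cont]] by simp
  have vm: "v \<in> borel_measurable borel" using v_cont by (rule borel_measurable_continuous_onI)
  have fv: "F t (v t) = f t (v t)" if "0 \<le> t" "t < S" for t using Dom(1)[OF v_Dom[OF that]] .
  have fv_L1: "(\<lambda>t. f t (v t)) \<in> L1_loc S"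
    by (rule L1_loc_of_continuous[OF Fv_cont]) (simp add: fv)
  have v_L1: "v \<in> L1_loc S" by (rule L1_loc_of_continuous[OF v_cont]) simp
  have "dist_eq S (caputo \<gamma> c v) (regular_dist (zero_ext (\<lambda>s. F s (v s))))"
    by (rule caputo_eq_of_volterra) (use \<gamma> S v_cont Fv_cont v in auto)
  \<comment> \<open>From \<open>S\<close> on the two right-hand sides may differ, but test functions
    vanish there.\<close>
  moreover have "regular_dist (zero_ext (\<lambda>s. F s (v s))) \<psi> = regular_dist (zero_ext (\<lambda>t. f t (v t))) \<psi>"
    if \<psi>: "\<psi> \<in> test_functions S" for \<psi>
  proof -
    obtain b where b: "b < S" "\<And>t. b \<le> t \<Longrightarrow> \<psi> t = 0" using test_function_support[OF \<psi> S] by metis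
    have "zero_ext (\<lambda>s. F s (v s)) t * \<psi> t = zero_ext (\<lambda>t. f t (v t)) t * \<psi> t" for t
      using b fv[of t] by (cases "t < S") (auto simp: zero_ext_def)
    then show ?thesis unfolding regular_dist_def by (simp only:)
  qed
  ultimately have eqn: "dist_eq S (caputo \<gamma> c v) (regular_dist (zero_ext (\<lambda>t. f t (v t))))"
    by (simp add: dist_eq_def)
  have weak: "weak_solution \<gamma> f Dom c S v"
    unfolding weak_solution_def using v_L1 fv_L1 eqn v_Dom by auto
  have v0: "v 0 = c" using v[of 0] S by simp
  have strong: "strong_solution \<gamma> f Dom c S v"
    unfolding strong_solution_def
  proof (intro conjI)
    show "v \<in> X_space S"
      unfolding X_space_def using v_L1 has_initial_value_iff[OF v_cont] by auto
    show "initial_value v = c"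
      unfolding initial_value_def has_initial_value_iff[OF v_cont] using v0 by auto
    show "\<exists>h\<in>L1_loc S. dist_eq S (caputo \<gamma> c v) (regular_dist (zero_ext h)) \<and>
        (AE t in lebesgue. t \<in> {0..<S} \<longrightarrow> h t = f t (v t))"
      using fv_L1 eqn by (intro bexI[of _ "\<lambda>t. f t (v t)"]) auto
  qed (use weak fv_L1 in auto)
  have "AE t in lebesgue. t \<in> {0..<S} \<longrightarrow> w t = v t" if "strong_solution \<gamma> f Dom c S w" for w
  proof -
    have w: "w \<in> L1_loc S" "AE t in lebesgue. t \<in> {0..<S} \<longrightarrow> (t, w t) \<in> Dom"
        "(\<lambda>t. f t (w t)) \<in> L1_loc S" "dist_eq S (caputo \<gamma> c w) (regular_dist (zero_ext (\<lambda>t. f t (w t))))"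
      using that by (auto simp: strong_solution_def weak_solution_def)
    obtain g where g: "g \<in> borel_measurable lborel" "AE t in lborel. indicator {0..<S} t * w t = g t"
      using completion_ex_borel_measurable_real[OF L1_loc_measurable[OF w(1)]] by auto
    \<comment> \<open>Clamping makes the representative bounded everywhere and changes nothing
      almost everywhere on (0,S), where membership of \<open>(t, w t)\<close> in \<open>Dom\<close>
      bounds \<open>w t\<close> by \<open>R\<close>.\<close>
    define w' where "w' t = max (- R) (min R (g t))" for t
    have w'm: "w' \<in> borel_measurable borel" using g(1) unfolding w'_def[abs_def] by measurable
    define h' where "h' t = F t (w' t)" for t
    have h'm: "h' \<in> borel_measurable borel"
      unfolding h'_def[abs_def] by (rule continuous_compose_measurable[OF cont w'm])
    have eq: "AE t in lebesgue. 0 < t \<and> t < S \<longrightarrow> w t = w' t \<and> f t (w t) = h' t"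
      using AE_completion[OF g(2)] w(2)
    proof eventually_elim
      case (elim t)
      show ?case
      proof
        assume t: "0 < t \<and> t < S"
        then have D: "(t, w t) \<in> Dom" and gt: "g t = w t" using elim by auto
        have "w t = w' t" using Dom(2)[OF D] gt by (auto simp: w'_def abs_le_iff)
        then show "w t = w' t \<and> f t (w t) = h' t" using Dom(1)[OF D] by (simp add: h'_def)
      qed
    qed
    \<comment> \<open>\<open>w'\<close> satisfies the integral equation only almost everywhere.
      \<open>W\<close> does so at every point of (0,S), because \<open>frac_int\<close> does not see
      null sets, and this is what \<open>volterra_stability\<close> asks for.\<close>
    define W where "W t = c + frac_int \<gamma> h' t" for t
    have Wm: "W \<in> borel_measurable borel" using h'm unfolding W_def[abs_def] by measurable
    have wW: "AE t in lborel. 0 < t \<and> t < S \<longrightarrow> w' t = W t"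
      unfolding W_def
    proof (rule volterra_of_weak[OF \<gamma> w(4) L1_loc_measurable[OF w(1)] L1_loc_measurable[OF w(3)] w'm h'm _ _ eq])
      show "\<bar>w' t\<bar> \<le> \<bar>R\<bar> + B" "\<bar>h' t\<bar> \<le> \<bar>R\<bar> + B" for t
        using B[of t "w' t"] by (auto simp: w'_def h'_def)
    qed
    have W: "W t = c + frac_int \<gamma> (\<lambda>s. F s (W s)) t" if "0 < t" "t < S" for t
    proof -
      have "AE s in lborel. 0 < s \<and> s < t \<longrightarrow> h' s = F s (W s)"
        using wW by eventually_elim (use that in \<open>auto simp: h'_def\<close>)
      from frac_int_cong[OF this h'm continuous_compose_measurable[OF cont Wm], of \<gamma>]
      show ?thesis by (simp add: W_def[of t])
    qed
    have Wv: "W t = v t" if "0 < t" "t < S" for t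
      using volterra_stability[OF \<gamma>(1) L cont B lip Wm vm W v that] by simp
    have "AE t in lebesgue. t \<noteq> (0::real)" by (rule AE_completion[OF AE_lborel_singleton])
    then show ?thesis
      using eq AE_completion[OF wW]
      by eventually_elim (auto simp: Wv)
  qed
  then show ?thesis using strong by (simp add: unique_strong_solution_def)
qed

section \<open>The growth bound and the existence time\<close>

definition radius_bound :: "real \<Rightarrow> real \<Rightarrow> real \<Rightarrow> real \<Rightarrow> real" where
  "radius_bound \<gamma> L M t = M / Gamma (1 + \<gamma>) * t powr \<gamma> * mittag_leffler \<gamma> (L * t powr \<gamma>)"

lemma radius_bound_mono:
  assumes "0 < \<gamma>" "0 \<le> L" "0 \<le> M" "0 \<le> s" "s \<le> t"
  shows "radius_bound \<gamma> L M s \<le> radius_bound \<gamma> L M t"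
  unfolding radius_bound_def using assms mittag_leffler_ge_1[of \<gamma> "L * s powr \<gamma>"]
  by (intro mult_mono mittag_leffler_mono powr_mono2 mult_left_mono divide_nonneg_nonneg Gamma_real_nonneg mult_nonneg_nonneg) auto

text \<open>Strictness provides the room between the growth bound and \<open>A\<close> before the
  existence time. For \<open>M = 0\<close> the bound is constantly 0, hence the assumption
  \<open>0 < M\<close>.\<close>

lemma radius_bound_strict_mono:
  assumes "0 < \<gamma>" "0 \<le> L" "0 < M" "0 \<le> s" "s < t"
  shows "radius_bound \<gamma> L M s < radius_bound \<gamma> L M t"
proof -
  have c: "0 < M / Gamma (1 + \<gamma>)" using assms by (intro divide_pos_pos Gamma_real_pos) auto
  have E: "1 \<le> mittag_leffler \<gamma> (L * s powr \<gamma>)" using assms by (intro mittag_leffler_ge_1) auto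
  have "M / Gamma (1 + \<gamma>) * s powr \<gamma> * mittag_leffler \<gamma> (L * s powr \<gamma>)
    < M / Gamma (1 + \<gamma>) * t powr \<gamma> * mittag_leffler \<gamma> (L * s powr \<gamma>)"
    using c E assms by (intro mult_strict_right_mono mult_strict_left_mono powr_less_mono2) auto
  also have "\<dots> \<le> M / Gamma (1 + \<gamma>) * t powr \<gamma> * mittag_leffler \<gamma> (L * t powr \<gamma>)"
    using c assms by (intro mult_left_mono mittag_leffler_mono powr_mono2 mult_nonneg_nonneg) auto
  finally show ?thesis by (simp add: radius_bound_def)
qed

text \<open>The last claim offers a point beyond \<open>t\<close> instead of a bound at
  \<open>t\<close>: with strict monotonicity this yields a strict inequality at \<open>t\<close>,
  and the supremum need not be attained.\<close>

lemma existence_time_properties: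
  assumes \<gamma>: "0 < \<gamma>" and "0 < T" "0 < A" "0 \<le> L" "0 \<le> M"
  defines "T1 \<equiv> existence_time \<gamma> T A L M"
  shows "0 < T1" "T1 \<le> T"
    and "\<And>t. t < T1 \<Longrightarrow> \<exists>s>t. 0 \<le> s \<and> radius_bound \<gamma> L M s \<le> A"
proof -
  define Z where "Z = {t. 0 \<le> t \<and> radius_bound \<gamma> L M t \<le> A}"
  define C where "C = M / Gamma (1 + \<gamma>) * mittag_leffler \<gamma> L"
  have C: "0 \<le> C"
    unfolding C_def using assms mittag_leffler_ge_1[of \<gamma> L]
    by (intro mult_nonneg_nonneg divide_nonneg_nonneg Gamma_real_nonneg) auto
  \<comment> \<open>A positive time in \<open>Z\<close> is found with \<open>s0 \<le> 1\<close>, so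
    that the Mittag-Leffler factor is at most its value at \<open>L\<close>, and with
    \<open>s0 powr \<gamma> \<le> x\<close>. The denominator \<open>C + 1\<close> is positive also
    when \<open>M = 0\<close>.\<close>
  define x where "x = A / (C + 1)"
  define s0 where "s0 = min 1 (x powr (1 / \<gamma>))"
  have x: "0 < x" "C * x \<le> A" using C assms by (auto simp: x_def field_simps)
  have s0: "0 < s0" "s0 \<le> 1" using x by (auto simp: s0_def)
  have "s0 powr \<gamma> \<le> (x powr (1 / \<gamma>)) powr \<gamma>" using s0 \<gamma> by (intro powr_mono2) (auto simp: s0_def)
  then have s0x: "s0 powr \<gamma> \<le> x" using x \<gamma> by (simp add: powr_powr)
  have "s0 powr \<gamma> \<le> 1" using s0 \<gamma> powr_mono2[of \<gamma> s0 1] by simp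
  then have "mittag_leffler \<gamma> (L * s0 powr \<gamma>) \<le> mittag_leffler \<gamma> L"
    using assms by (intro mittag_leffler_mono) (auto intro: mult_left_le)
  then have "radius_bound \<gamma> L M s0 \<le> M / Gamma (1 + \<gamma>) * s0 powr \<gamma> * mittag_leffler \<gamma> L"
    unfolding radius_bound_def using assms
    by (intro mult_left_mono mult_nonneg_nonneg divide_nonneg_nonneg Gamma_real_nonneg) auto
  also have "\<dots> = C * s0 powr \<gamma>" by (simp add: C_def)
  also have "\<dots> \<le> C * x" using C s0x by (intro mult_left_mono)
  finally have "s0 \<in> Z" using s0 x by (simp add: Z_def)
  then have sup: "ereal s0 \<le> (SUP t\<in>Z. ereal t)" by (rule SUP_upper)
  define m where "m = min (ereal T) (SUP t\<in>Z. ereal t)"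
  have T1: "T1 = real_of_ereal m"
    by (simp add: T1_def existence_time_def m_def Z_def radius_bound_def)
  \<comment> \<open>\<open>m\<close> lies between two real numbers, so it is finite and
    \<open>real_of_ereal\<close> is faithful even when the supremum is infinite.\<close>
  define y where "y = min T s0"
  have m: "ereal y \<le> m" "m \<le> ereal T" using sup by (auto simp: m_def y_def min_def intro: order_trans[of _ "ereal s0"])
  then have T1m: "ereal T1 = m" unfolding T1 by (cases m) auto
  have "y \<le> T1" using m(1) unfolding T1m[symmetric] by simp
  then show "0 < T1" using s0 assms by (simp add: y_def)
  show "T1 \<le> T" using m(2) unfolding T1m[symmetric] by simp
  fix t assume "t < T1"
  then have "ereal t < m" unfolding T1m[symmetric] by simp
  then have "ereal t < (SUP t\<in>Z. ereal t)" by (simp add: m_def)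
  then obtain s where "s \<in> Z" "ereal t < ereal s" unfolding less_SUP_iff by blast
  then show "\<exists>s>t. 0 \<le> s \<and> radius_bound \<gamma> L M s \<le> A" by (auto simp: Z_def)
qed

text \<open>Projecting both arguments onto the intervals is continuous and does not increase
  distances, so \<open>L\<close> survives. As \<open>v0\<close> is fixed by the projection, the
  values \<open>F t v0\<close> are values of \<open>f\<close> at \<open>v0\<close>, so a bound for
  those survives too.\<close>

lemma clamped_extension:
  fixes f :: "real \<Rightarrow> real \<Rightarrow> real"
  assumes T: "0 \<le> T" and A: "0 \<le> A" and L: "0 \<le> L"
    and cont: "continuous_on ({0..T} \<times> {v0 - A..v0 + A}) (\<lambda>(t, x). f t x)"
    and lip: "\<And>t x y. t \<in> {0..T} \<Longrightarrow> x \<in> {v0 - A..v0 + A} \<Longrightarrow> y \<in> {v0 - A..v0 + A} \<Longrightarrow> \<bar>f t x - f t y\<bar> \<le> L * \<bar>x - y\<bar>"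
  obtains F B where "continuous_on UNIV (\<lambda>(t, x). F t x)" "\<And>t x. \<bar>F t x\<bar> \<le> (B :: real)"
    "\<And>t x y. \<bar>F t x - F t y\<bar> \<le> L * \<bar>x - y\<bar>"
    "\<And>t x. (t, x) \<in> {0..T} \<times> {v0 - A..v0 + A} \<Longrightarrow> F t x = f t x"
    "\<And>t. \<exists>s\<in>{0..T}. F t v0 = f s v0"
proof -
  define p where "p t = max 0 (min T t)" for t
  define q where "q x = max (v0 - A) (min (v0 + A) x)" for x
  have p: "p t \<in> {0..T}" and q: "q x \<in> {v0 - A..v0 + A}" for t x using T A by (auto simp: p_def q_def)
  define F where "F t x = f (p t) (q x)" for t x
  obtain B where B: "\<And>z. z \<in> {0..T} \<times> {v0 - A..v0 + A} \<Longrightarrow> norm ((\<lambda>(t, x). f t x) z) \<le> B"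
  proof -
    have "bounded ((\<lambda>(t, x). f t x) ` ({0..T} \<times> {v0 - A..v0 + A}))"
      by (intro compact_imp_bounded compact_continuous_image cont compact_Times) auto
    then show ?thesis using that unfolding bounded_iff by blast
  qed
  show ?thesis
  proof (rule that[of F B])
    have "continuous_on UNIV (\<lambda>z. (p (fst z), q (snd z)))"
      unfolding p_def q_def by (intro continuous_intros)
    from continuous_on_compose2[OF cont this]
    have "continuous_on UNIV (\<lambda>z. case (p (fst z), q (snd z)) of (t, x) \<Rightarrow> f t x)"
      using p q by blast
    then show "continuous_on UNIV (\<lambda>(t, x). F t x)"
      by (simp add: F_def split_beta)
    show "\<bar>F t x\<bar> \<le> B" for t x using B[of "(p t, q x)"] p q by (simp add: F_def)
    fix t x y
    have "\<bar>F t x - F t y\<bar> \<le> L * \<bar>q x - q y\<bar>" unfolding F_def by (rule lip[OF p q q])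
    also have "\<dots> \<le> L * \<bar>x - y\<bar>" by (intro mult_left_mono L) (auto simp: q_def)
    finally show "\<bar>F t x - F t y\<bar> \<le> L * \<bar>x - y\<bar>" .
  next
    fix t x assume "(t, x) \<in> {0..T} \<times> {v0 - A..v0 + A}"
    then show "F t x = f t x" by (simp add: F_def p_def q_def)
  next
    fix t show "\<exists>s\<in>{0..T}. F t v0 = f s v0" using p[of t] A by (intro bexI[of _ "p t"]) (simp_all add: F_def q_def)
  qed
qed

section \<open>Existence, uniqueness and dependence on the initial value\<close>

theorem theorem4p4:
  fixes \<gamma> v0 T A L M T1 :: real
    and f :: "real \<Rightarrow> real \<Rightarrow> real"
    and Dom :: "(real \<times> real) set"
  assumes "0 < \<gamma>" and "\<gamma> < 1"
    and "T > 0" and "A > 0" and "L > 0"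
    and "Dom = {0..T} \<times> {v0 - A..v0 + A}"
    and "continuous_on Dom (\<lambda>(t, x). f t x)"
    and "\<forall>v1\<in>{v0 - A..v0 + A}. \<forall>v2\<in>{v0 - A..v0 + A}.
           (SUP t\<in>{0..T}. \<bar>f t v1 - f t v2\<bar>) \<le> L * \<bar>v1 - v2\<bar>"
    and "M = (SUP t\<in>{0..T}. \<bar>f t v0\<bar>)"
    and "T1 = existence_time \<gamma> T A L M"
  shows "T1 > 0 \<and>
    (\<exists>v. unique_strong_solution \<gamma> f Dom v0 T1 v \<and>
         continuous_on {0..T1} v \<and>
         (\<forall>t \<epsilon>0. 0 < t \<and> t < T1 \<and> 0 < \<epsilon>0 \<and> \<epsilon>0 < T1 - t \<longrightarrow>
           (\<forall>\<epsilon>. 0 < \<epsilon> \<and> \<epsilon> < \<epsilon>0 \<longrightarrow>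
             (\<exists>\<delta>0>0. \<forall>\<delta>. \<bar>\<delta>\<bar> \<le> \<delta>0 \<longrightarrow>
               (\<exists>v\<delta>. unique_strong_solution \<gamma> f Dom (v0 + \<delta>) (T1 - \<epsilon>0) v\<delta> \<and>
                     continuous_on {0..<T1 - \<epsilon>0} v\<delta> \<and>
                     \<bar>v\<delta> t - v t\<bar> < \<epsilon>)))))"
proof -
  note \<gamma> = assms(1,2)
  have cont: "continuous_on ({0..T} \<times> {v0 - A..v0 + A}) (\<lambda>(t, x). f t x)" using assms by simp
  \<comment> \<open>A real supremum is known to bound its members only when the set is bounded
    above; continuity and compactness supply this for the Lipschitz condition and for
    \<open>M\<close>.\<close>
  have bdd: "bdd_above ((\<lambda>t. \<bar>k t\<bar>) ` {0..T})" if "continuous_on {0..T} k" for k :: "real \<Rightarrow> real"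
    by (intro compact_imp_bounded[THEN bounded_imp_bdd_above] compact_continuous_image continuous_intros that) auto
  have f_cont: "continuous_on {0..T} (\<lambda>t. f t x)" if "x \<in> {v0 - A..v0 + A}" for x
  proof -
    have "continuous_on {0..T} (\<lambda>t. (t, x))" by (intro continuous_intros)
    moreover have "(\<lambda>t. (t, x)) ` {0..T} \<subseteq> {0..T} \<times> {v0 - A..v0 + A}" using that by auto
    ultimately show ?thesis using continuous_on_compose2[OF cont] by fastforce
  qed
  have lip: "\<bar>f t x - f t y\<bar> \<le> L * \<bar>x - y\<bar>"
    if "t \<in> {0..T}" "x \<in> {v0 - A..v0 + A}" "y \<in> {v0 - A..v0 + A}" for t x y
  proof -
    have "\<bar>f t x - f t y\<bar> \<le> (SUP t\<in>{0..T}. \<bar>f t x - f t y\<bar>)"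
      by (rule cSUP_upper[OF that(1)]) (intro bdd continuous_intros f_cont that)
    then show ?thesis using assms(8) that(2,3) by (blast intro: order_trans)
  qed
  have M: "\<bar>f t v0\<bar> \<le> M" if "t \<in> {0..T}" for t
    unfolding assms(9) by (rule cSUP_upper[OF that]) (use assms in \<open>auto intro!: bdd f_cont\<close>)
  have M0: "0 \<le> M" using order_trans[OF abs_ge_zero M[of 0]] assms by simp
  obtain F B where F: "continuous_on UNIV (\<lambda>(t, x). F t x)" "\<And>t x. \<bar>F t x\<bar> \<le> (B :: real)"
    "\<And>t x y. \<bar>F t x - F t y\<bar> \<le> L * \<bar>x - y\<bar>"
    "\<And>t x. (t, x) \<in> {0..T} \<times> {v0 - A..v0 + A} \<Longrightarrow> F t x = f t x"
    "\<And>t. \<exists>s\<in>{0..T}. F t v0 = f s v0"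
  proof (rule clamped_extension[of T A L v0 f])
    show "0 \<le> T" "0 \<le> A" "0 \<le> L" using assms by auto
    show "continuous_on ({0..T} \<times> {v0 - A..v0 + A}) (\<lambda>(t, x). f t x)" by (rule cont)
    show "\<bar>f t x - f t y\<bar> \<le> L * \<bar>x - y\<bar>"
      if "t \<in> {0..T}" "x \<in> {v0 - A..v0 + A}" "y \<in> {v0 - A..v0 + A}" for t x y
      using that by (rule lip)
  qed (rule that)
  have FM: "\<bar>F t v0\<bar> \<le> M" for t using F(5)[of t] M by auto
  have L0: "0 \<le> L" using assms by simp
  note T1 = existence_time_properties[OF \<gamma>(1) assms(3,4) L0 M0, folded assms(10)]
  \<comment> \<open>The clamped equation is solvable on all of [0,T] for every \<open>c\<close>;
    staying within \<open>A\<close> of \<open>v0\<close> is what turns its solutions into solutions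
    of the original problem.\<close>
  have exists: "\<exists>v. continuous_on UNIV v \<and> (\<forall>t. 0 \<le> t \<longrightarrow> t \<le> T \<longrightarrow> v t = c + frac_int \<gamma> (\<lambda>s. F s (v s)) t)" for c
    using volterra_solution_exists[OF \<gamma>(1) less_imp_le[OF \<gamma>(2)] assms(3) L0 F(1-3), of c] by blast
  obtain v where v: "continuous_on UNIV v" "\<And>t. 0 \<le> t \<Longrightarrow> t \<le> T \<Longrightarrow> v t = v0 + frac_int \<gamma> (\<lambda>s. F s (v s)) t"
    using exists[of v0] by blast
  have meas: "u \<in> borel_measurable borel" if "continuous_on UNIV u" for u :: "real \<Rightarrow> real"
    using that by (rule borel_measurable_continuous_onI)
  have growth: "\<bar>v t - v0\<bar> \<le> radius_bound \<gamma> L M t" if "0 \<le> t" "t < T1" for t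
  proof (cases "t = 0")
    case True
    then show ?thesis using v(2)[of 0] assms by (simp add: radius_bound_def)
  next
    case False
    then show ?thesis
      using volterra_growth[OF \<gamma>(1) L0 F(1-3) FM meas[OF v(1)], of T t] v(2) that T1(2)
      by (simp add: radius_bound_def g_kernel_def add.commute)
  qed
  have uss: "unique_strong_solution \<gamma> f Dom c S u"
    if "0 < S" "S \<le> T" "continuous_on UNIV u" "\<And>t. 0 \<le> t \<Longrightarrow> t \<le> T \<Longrightarrow> u t = c + frac_int \<gamma> (\<lambda>s. F s (u s)) t"
      "\<And>t. 0 \<le> t \<Longrightarrow> t < S \<Longrightarrow> \<bar>u t - v0\<bar> \<le> A" for c S u
  proof (rule unique_strong_solution_of_volterra[OF \<gamma> L0 that(1) F(1-3) _ _ that(3)])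
    show "F t x = f t x" if "(t, x) \<in> Dom" for t x using F(4) that assms(6) by blast
    show "\<bar>x\<bar> \<le> \<bar>v0\<bar> + A" if "(t, x) \<in> Dom" for t x using that unfolding assms(6) by auto
    show "u t = c + frac_int \<gamma> (\<lambda>s. F s (u s)) t" if "0 \<le> t" "t < S" for t using that \<open>S \<le> T\<close> \<open>\<And>t. 0 \<le> t \<Longrightarrow> t \<le> T \<Longrightarrow> u t = _ t\<close> by simp
    show "(t, u t) \<in> Dom" if t: "0 \<le> t" "t < S" for t
      using t \<open>S \<le> T\<close> \<open>\<And>t. 0 \<le> t \<Longrightarrow> t < S \<Longrightarrow> \<bar>u t - v0\<bar> \<le> A\<close>[OF t] unfolding assms(6) by (auto simp: abs_le_iff)
  qed
  have v_uss: "unique_strong_solution \<gamma> f Dom v0 T1 v"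
  proof (rule uss[OF T1(1,2) v])
    fix t assume t: "0 \<le> t" "t < T1"
    obtain s where "t < s" "0 \<le> s" "radius_bound \<gamma> L M s \<le> A" using T1(3)[OF t(2)] by blast
    then show "\<bar>v t - v0\<bar> \<le> A"
      using growth[OF t] radius_bound_mono[OF \<gamma>(1) L0 M0 t(1), of s] by linarith
  qed auto
  \<comment> \<open>Taken at \<open>T\<close>, the factor bounds the stability estimate at all times
    at once.\<close>
  define E where "E = mittag_leffler \<gamma> (L * T powr \<gamma>)"
  have E: "1 \<le> E" unfolding E_def using L0 by (intro mittag_leffler_ge_1 \<gamma>) auto
  have "\<exists>\<delta>0>0. \<forall>\<delta>. \<bar>\<delta>\<bar> \<le> \<delta>0 \<longrightarrow> (\<exists>v\<delta>. unique_strong_solution \<gamma> f Dom (v0 + \<delta>) (T1 - \<epsilon>0) v\<delta> \<and>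
       continuous_on {0..<T1 - \<epsilon>0} v\<delta> \<and> \<bar>v\<delta> t - v t\<bar> < \<epsilon>)"
    if t: "0 < t" "t < T1" and \<epsilon>: "0 < \<epsilon>0" "\<epsilon>0 < T1 - t" "0 < \<epsilon>" for t \<epsilon>0 \<epsilon>
  proof -
    define S where "S = T1 - \<epsilon>0"
    have S: "0 < S" "S < T1" "t < S" "S \<le> T" using t \<epsilon> T1 by (auto simp: S_def)
    \<comment> \<open>Before \<open>S\<close> the unperturbed solution moves by at most
      \<open>A'\<close>, which leaves \<open>A - A'\<close> for the perturbation.\<close>
    define A' where "A' = radius_bound \<gamma> L M S"
    have A': "0 \<le> A'" "A' < A"
    proof -
      show "0 \<le> A'" using radius_bound_mono[OF \<gamma>(1) L0 M0 order_refl, of S] S by (simp add: A'_def radius_bound_def)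
      obtain s where s: "S < s" "0 \<le> s" "radius_bound \<gamma> L M s \<le> A" using T1(3)[OF S(2)] by blast
      show "A' < A"
      proof (cases "M = 0")
        case True
        then show ?thesis using assms by (simp add: A'_def radius_bound_def)
      next
        case False
        then have "0 < M" using M0 by simp
        then have "A' < radius_bound \<gamma> L M s"
          unfolding A'_def using S s by (intro radius_bound_strict_mono \<gamma> L0) auto
        then show ?thesis using s by linarith
      qed
    qed
    \<comment> \<open>Dividing by \<open>E\<close> cancels the amplification in the stability
      estimate. \<open>\<epsilon> / 2\<close> yields the strict inequality, \<open>A - A'\<close>
      keeps the perturbed solution in \<open>Dom\<close>.\<close>
    define \<delta>0 where "\<delta>0 = min (\<epsilon> / 2) (A - A') / E"
    have \<delta>0: "0 < \<delta>0" using E A' \<epsilon> by (simp add: \<delta>0_def)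
    show ?thesis
    proof (intro exI[of _ \<delta>0] conjI allI impI \<delta>0)
      fix \<delta> assume "\<bar>\<delta>\<bar> \<le> \<delta>0"
      then have "\<bar>\<delta>\<bar> * E \<le> min (\<epsilon> / 2) (A - A')" using E by (simp add: \<delta>0_def pos_le_divide_eq)
      then have \<delta>: "\<bar>\<delta>\<bar> * E \<le> \<epsilon> / 2" "\<bar>\<delta>\<bar> * E \<le> A - A'" by auto
      obtain u where u: "continuous_on UNIV u" "\<And>t. 0 \<le> t \<Longrightarrow> t \<le> T \<Longrightarrow> u t = v0 + \<delta> + frac_int \<gamma> (\<lambda>s. F s (u s)) t"
        using exists[of "v0 + \<delta>"] by blast
      have diff: "\<bar>u s - v s\<bar> \<le> \<bar>\<delta>\<bar> * E" if "0 \<le> s" "s < S" for s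
      proof (cases "s = 0")
        case True
        then show ?thesis using u(2)[of 0] v(2)[of 0] assms(3) E mult_left_mono[OF E, of "\<bar>\<delta>\<bar>"] by simp
      next
        case False
        then have "\<bar>u s - v s\<bar> \<le> \<bar>v0 + \<delta> - v0\<bar> * mittag_leffler \<gamma> (L * s powr \<gamma>)"
          by (intro volterra_stability[OF \<gamma>(1) L0 F(1-3) meas[OF u(1)] meas[OF v(1)], where S = T] u(2) v(2))
             (use that S in auto)
        also have "\<dots> \<le> \<bar>v0 + \<delta> - v0\<bar> * E"
          unfolding E_def using that S \<gamma> L0
          by (intro mult_left_mono mittag_leffler_mono powr_mono2) auto
        finally show ?thesis by simp
      qed
      have "unique_strong_solution \<gamma> f Dom (v0 + \<delta>) S u"
      proof (rule uss[OF S(1,4) u])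
        fix s assume s: "0 \<le> s" "s < S"
        have "radius_bound \<gamma> L M s \<le> A'"
          unfolding A'_def using s by (intro radius_bound_mono \<gamma> L0 M0) auto
        then show "\<bar>u s - v0\<bar> \<le> A"
          using growth[of s] diff[OF s] \<delta>(2) s S by linarith
      qed auto
      moreover have "\<bar>u t - v t\<bar> < \<epsilon>" using diff[of t] t S \<delta>(1) \<epsilon> by linarith
      ultimately show "\<exists>v\<delta>. unique_strong_solution \<gamma> f Dom (v0 + \<delta>) (T1 - \<epsilon>0) v\<delta> \<and>
         continuous_on {0..<T1 - \<epsilon>0} v\<delta> \<and> \<bar>v\<delta> t - v t\<bar> < \<epsilon>"
        using continuous_on_subset[OF u(1) subset_UNIV] by (auto simp: S_def)
    qed
  qed
  then show ?thesis
    using T1(1) v_uss continuous_on_subset[OF v(1) subset_UNIV] by (intro conjI exI[of _ v]) blast+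
qed

end
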